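(* Let $\mathcal N$ and $\mathcal M$ be quantum channels on $n$-qubit operators that both satisfy $s$-detailed balance with respect to $\rho_\beta$ (for some fixed $s\in[0,1]$), such that $\mathcal N$ has $\rho_\beta$ as its unique fixed state and the spectrum of $\mathcal N$ lies in $[0,1]$. Suppose moreover that the linear map $\widehat{\mathcal M}$ also satisfies $s$-detailed balance with respect to $\rho_\beta$, and that $\mathbb V_{\rho_\beta}(\mathcal M)>0$. Let $\rho$ be an arbitrary initial state, let $\epsilon,\eta>0$, set $T_{burn}:=t_{mix}(\eta)$, and let $K$ be an integer with $$K\ \ge\ \frac{2\,\mathbb V_{\rho_\beta}(\mathcal M)}{\epsilon^2\eta}\left(\frac{\mathbf p}{\mathrm{gap}(\mathcal N)}+\frac12\right),\qquad \mathbf p:=\frac{\mathrm{Cov}_{\rho_\beta}(\mathcal M)}{\mathbb V_{\rho_\beta}(\mathcal M)}.$$ Then the outcomes $e_1,\dots,e_K$ of the single-trajectory algorithm run with inputs $\mathcal N,\mathcal M,\rho,T_{burn},K$ satisfy $$\Pr_\rho\left(\left|\frac1K\sum_{t=1}^K e_t-\mathbb E_{\rho_\beta}(\mathcal M)\right|\ge \epsilon\right)\le 2\eta .$$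
   Context: Let $H$ be a Hermitian operator on $n$ qubits, $\beta>0$, and $\rho_\beta=e^{-\beta H}/\operatorname{tr}(e^{-\beta H})$ (a positive definite density matrix). A quantum channel is a completely positive trace-preserving map $\mathcal T(X)=\sum_u K_uXK_u^\dagger$; its dual (Heisenberg picture) is $\mathcal T^\dagger(X)=\sum_uK_u^\dagger XK_u$, which is the adjoint w.r.t. $\langle A,B\rangle=\operatorname{tr}(A^\dagger B)$; for a general linear map on matrices, $\mathcal T^\dagger$ denotes its Hilbert–Schmidt adjoint. For $s\in[0,1]$ define $\langle A,B\rangle_s=\operatorname{tr}(A^\dagger\rho_\beta^{1-s}B\rho_\beta^{s})$. A linear map $\mathcal T$ satisfies $s$-detailed balance w.r.t. $\rho_\beta$ if $\langle A,\mathcal T^\dagger(B)\rangle_s=\langle\mathcal T^\dagger(A),B\rangle_s$ for all $A,B$. The spectrum of a map is its set of eigenvalues as a linear map on matrices. For a channel $\mathcal T$ satisfying $s$-detailed balance, $\mathrm{gap}(\mathcal T):=1-\max_{X\neq0,\ \langle X,I\rangle_s=0}\langle X,\mathcal T^\dagger(X)\rangle_s/\langle X,X\rangle_s$. Measurements: $\mathcal M$ has Kraus operators $\{O_u\}_u$ indexed by a finite set of real numbers $u$ (the outcomes); applied to $\rho$ it gives outcome $u$ with probability $\operatorname{tr}(O_u\rho O_u^\dagger)$ and post-measurement state proportional to $O_u\rho O_u^\dagger$. $\mathbb E_{\rho}(\mathcal M)=\sum_u u\operatorname{tr}(O_u\rho O_u^\dagger)$, $\mathbb V_{\rho}(\mathcal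 M)=\sum_u|u-\mathbb E_\rho(\mathcal M)|^2\operatorname{tr}(O_u\rho O_u^\dagger)$, $\mathrm{Cov}_\rho(\mathcal M)=\sum_{x,y}(x-\mathbb E_\rho(\mathcal M))(y-\mathbb E_\rho(\mathcal M))\operatorname{tr}(O_yO_x\rho O_x^\dagger O_y^\dagger)$. Define the linear map $\widehat{\mathcal M}(X)=\sum_u(u-\mathbb E_{\rho_\beta}(\mathcal M))O_uXO_u^\dagger$. Mixing time: $t_{mix}(\eta)=\min\{t\in\mathbb N:\|\mathcal N^t(\sigma)-\rho_\beta\|_1\le\eta\ \text{for all states }\sigma\}$. Single-trajectory algorithm with inputs $\mathcal N,\mathcal M$, initial state $\rho$, integers $T_{burn},K$: apply $\mathcal N$ $T_{burn}$ times to $\rho$; then for $t=1,\dots,K$ apply $\mathcal M$ (record its outcome as $e_t$), then $\mathcal N$, then $\mathcal M$ again (its outcome discarded); i.e. each round applies $\mathcal M\circ\mathcal N\circ\mathcal M$ and $e_t$ is the outcome of the first (rightmost) $\mathcal M$. $\Pr_\rho$ denotes probability over all measurement outcomes of this process started from $\rho$. *)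

theory Defs
  imports "HOL-Analysis.Analysis"
begin

text \<open>Operators on n qubits: complex d x d matrices, d = CARD('d) (= 2^n in the theorem).\<close>

type_synonym 'd cmat = "complex^'d^'d"

definition cadj :: "'d::finite cmat \<Rightarrow> 'd cmat" where
  "cadj A = (\<chi> i j. cnj (A $ j $ i))"

definition diagm :: "('d::finite \<Rightarrow> complex) \<Rightarrow> 'd cmat" where
  "diagm d = (\<chi> i j. if i = j then d i else 0)"

definition cscale :: "complex \<Rightarrow> 'd::finite cmat \<Rightarrow> 'd cmat" where
  "cscale c A = (\<chi> i j. c * A $ i $ j)"

definition hermitian :: "'d::finite cmat \<Rightarrow> bool" where
  "hermitian A \<longleftrightarrow> cadj A = A"

definition unitary :: "'d::finite cmat \<Rightarrow> bool" where
  "unitary U \<longleftrightarrow> U ** cadj U = mat 1 \<and> cadj U ** U = mat 1"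

text \<open>Functional calculus for Hermitian matrices via the spectral decomposition
  A = U diag(d) U^dagger (independent of the chosen decomposition).\<close>
definition hfun :: "(real \<Rightarrow> real) \<Rightarrow> 'd::finite cmat \<Rightarrow> 'd cmat" where
  "hfun f A = (SOME B. \<exists>U d. unitary U \<and> A = U ** diagm (\<lambda>i. complex_of_real (d i)) ** cadj U
                 \<and> B = U ** diagm (\<lambda>i. complex_of_real (f (d i))) ** cadj U)"

definition mexp :: "'d::finite cmat \<Rightarrow> 'd cmat" where
  "mexp A = hfun exp A"

definition mpow :: "'d::finite cmat \<Rightarrow> real \<Rightarrow> 'd cmat" where
  "mpow A t = hfun (\<lambda>x. x powr t) A"

definition gibbs :: "real \<Rightarrow> 'd::finite cmat \<Rightarrow> 'd cmat" where
  "gibbs \<beta> H = (let E = mexp (- (\<beta> *\<^sub>R H)) in (1 / Re (trace E)) *\<^sub>R E)"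

definition trace_norm :: "'d::finite cmat \<Rightarrow> real" where
  "trace_norm A = Re (trace (hfun sqrt (cadj A ** A)))"

definition psd :: "'d::finite cmat \<Rightarrow> bool" where
  "psd A \<longleftrightarrow> (\<forall>v. let q = (\<Sum>i\<in>UNIV. cnj (v $ i) * (A *v v) $ i) in Im q = 0 \<and> Re q \<ge> 0)"

definition is_state :: "'d::finite cmat \<Rightarrow> bool" where
  "is_state \<sigma> \<longleftrightarrow> psd \<sigma> \<and> trace \<sigma> = 1"

definition is_channel :: "('d::finite cmat \<Rightarrow> 'd cmat) \<Rightarrow> bool" where
  "is_channel T \<longleftrightarrow> (\<exists>Ks :: 'd cmat list.
      (\<forall>X. T X = sum_list (map (\<lambda>K. K ** X ** cadj K) Ks)) \<and>
      sum_list (map (\<lambda>K. cadj K ** K) Ks) = mat 1)"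

definition hs_adj :: "('d::finite cmat \<Rightarrow> 'd cmat) \<Rightarrow> ('d cmat \<Rightarrow> 'd cmat)" where
  "hs_adj T = (SOME S. \<forall>A B. trace (cadj A ** T B) = trace (cadj (S A) ** B))"

definition sinner :: "'d::finite cmat \<Rightarrow> real \<Rightarrow> 'd cmat \<Rightarrow> 'd cmat \<Rightarrow> complex" where
  "sinner \<rho> s A B = trace (cadj A ** mpow \<rho> (1 - s) ** B ** mpow \<rho> s)"

definition detailed_balance :: "'d::finite cmat \<Rightarrow> real \<Rightarrow> ('d cmat \<Rightarrow> 'd cmat) \<Rightarrow> bool" where
  "detailed_balance \<rho> s T \<longleftrightarrow>
     (\<forall>A B. sinner \<rho> s A (hs_adj T B) = sinner \<rho> s (hs_adj T A) B)"

definition map_spectrum :: "('d::finite cmat \<Rightarrow> 'd cmat) \<Rightarrow> complex set" where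
  "map_spectrum T = {c. \<exists>X. X \<noteq> 0 \<and> T X = cscale c X}"

definition gap :: "'d::finite cmat \<Rightarrow> real \<Rightarrow> ('d cmat \<Rightarrow> 'd cmat) \<Rightarrow> real" where
  "gap \<rho> s T = 1 - Sup {Re (sinner \<rho> s X (hs_adj T X)) / Re (sinner \<rho> s X X) | X.
                             X \<noteq> 0 \<and> sinner \<rho> s X (mat 1) = 0}"

definition is_measurement :: "real set \<Rightarrow> (real \<Rightarrow> 'd::finite cmat) \<Rightarrow> bool" where
  "is_measurement U Ob \<longleftrightarrow> finite U \<and> (\<Sum>u\<in>U. cadj (Ob u) ** Ob u) = mat 1"

definition meas_channel :: "real set \<Rightarrow> (real \<Rightarrow> 'd::finite cmat) \<Rightarrow> 'd cmat \<Rightarrow> 'd cmat" where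
  "meas_channel U Ob X = (\<Sum>u\<in>U. Ob u ** X ** cadj (Ob u))"

definition outcome_prob :: "(real \<Rightarrow> 'd::finite cmat) \<Rightarrow> 'd cmat \<Rightarrow> real \<Rightarrow> real" where
  "outcome_prob Ob \<rho> u = Re (trace (Ob u ** \<rho> ** cadj (Ob u)))"

definition meas_E :: "real set \<Rightarrow> (real \<Rightarrow> 'd::finite cmat) \<Rightarrow> 'd cmat \<Rightarrow> real" where
  "meas_E U Ob \<rho> = (\<Sum>u\<in>U. u * outcome_prob Ob \<rho> u)"

definition meas_V :: "real set \<Rightarrow> (real \<Rightarrow> 'd::finite cmat) \<Rightarrow> 'd cmat \<Rightarrow> real" where
  "meas_V U Ob \<rho> = (\<Sum>u\<in>U. \<bar>u - meas_E U Ob \<rho>\<bar>^2 * outcome_prob Ob \<rho> u)"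

definition meas_Cov :: "real set \<Rightarrow> (real \<Rightarrow> 'd::finite cmat) \<Rightarrow> 'd cmat \<Rightarrow> real" where
  "meas_Cov U Ob \<rho> = (\<Sum>x\<in>U. \<Sum>y\<in>U. (x - meas_E U Ob \<rho>) * (y - meas_E U Ob \<rho>) *
       Re (trace (Ob y ** Ob x ** \<rho> ** cadj (Ob x) ** cadj (Ob y))))"

definition meas_hat :: "real set \<Rightarrow> (real \<Rightarrow> 'd::finite cmat) \<Rightarrow> 'd cmat \<Rightarrow> 'd cmat \<Rightarrow> 'd cmat" where
  "meas_hat U Ob \<rho> X = (\<Sum>u\<in>U. (u - meas_E U Ob \<rho>) *\<^sub>R (Ob u ** X ** cadj (Ob u)))"

definition t_mix :: "('d::finite cmat \<Rightarrow> 'd cmat) \<Rightarrow> 'd cmat \<Rightarrow> real \<Rightarrow> nat" where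
  "t_mix N \<rho> \<eta> = (LEAST t. \<forall>\<sigma>. is_state \<sigma> \<longrightarrow> trace_norm ((N ^^ t) \<sigma> - \<rho>) \<le> \<eta>)"

text \<open>Unnormalised state after the rounds with recorded outcomes es (in order e_1, e_2, ...):
  each round applies M o N o M, recording the outcome of the first M and discarding the second.\<close>
fun rounds :: "('d::finite cmat \<Rightarrow> 'd cmat) \<Rightarrow> real set \<Rightarrow> (real \<Rightarrow> 'd cmat) \<Rightarrow> real list \<Rightarrow> 'd cmat \<Rightarrow> 'd cmat" where
  "rounds N U Ob [] X = X"
| "rounds N U Ob (e # es) X = rounds N U Ob es (meas_channel U Ob (N (Ob e ** X ** cadj (Ob e))))"

definition traj_prob :: "('d::finite cmat \<Rightarrow> 'd cmat) \<Rightarrow> real set \<Rightarrow> (real \<Rightarrow> 'd cmat) \<Rightarrow> 'd cmat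
      \<Rightarrow> nat \<Rightarrow> nat \<Rightarrow> (real list \<Rightarrow> bool) \<Rightarrow> real" where
  "traj_prob N U Ob \<rho> Tb K P =
     (\<Sum>es\<in>{es. set es \<subseteq> U \<and> length es = K}.
        if P es then Re (trace (rounds N U Ob es ((N ^^ Tb) \<rho>))) else 0)"

end

(* The detailed-balance condition says that X |-> rho^(1-s) X rho^s intertwines the dual of each
   map with the map itself, so in the inner product (A, B) |-> Re <A, B>_s the duals n and m of N
   and M are self-adjoint. Both fix the identity; m is a contraction because orbits of a channel are
   bounded, and on the orthogonal complement of the identity |n X| <= lambda |X| with
   lambda = 1 - gap < 1.
   For the centred observable Y, the dual of Mhat applied to the identity, Cov = |Y|^2 and the
   stationary covariance of e_t and e_(t+j) is <Y, (m n m)^(j-1) m n Y>_s, at most lambda^j Cov.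
   Summing the geometric series bounds the variance of the sum of the outcomes by
   K (V + 2 Cov / gap), and Chebyshev's inequality gives probability at most eta in the stationary
   state. The burnt-in state is eta-close to stationary in trace norm, which costs another eta. *)

theory Submission
  imports Defs
begin

subsection \<open>Self-adjoint maps for a positive definite form\<close>

text \<open>Matrices are handled as a real Euclidean space with the form Re <A, B>_s, so that
  eigenvectors come from compactness of the unit sphere; only orthogonality to the identity is kept
  as a complex equation. The obstacle is that a bound on the Rayleigh quotient of n bounds |n X|
  only if n is nonnegative. This is where the spectrum of N in [0,1] enters, while lambda < 1 comes
  from uniqueness of the fixed state. For M no spectrum is given, whence the detour through bounded
  orbits. Detailed balance of Mhat makes the state weighted by its first centred outcome, Mhat(rho),
  equal to rho^(1-s) Y rho^s with Y orthogonal to the identity, so the correlations start inside the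
  contracted subspace. Moments are computed by recursion on the first outcome, with expectations
  extended linearly from states to signed inputs. The bound on K is exactly K >= (V + 2 Cov / gap) /
  (eps^2 eta). Finally, t_mix is the least element of a set whose nonemptiness has to be proved; the
  same contraction supplies it.\<close>

lemma psd_form_Cauchy_Schwarz:
  fixes q :: "'a::real_vector \<Rightarrow> 'a \<Rightarrow> real"
  assumes q: "bilinear q" and sym: "\<And>x y. q x y = q y x"
    and W: "subspace W" and nonneg: "\<And>x. x \<in> W \<Longrightarrow> 0 \<le> q x x"
    and x: "x \<in> W" and y: "y \<in> W"
  shows "(q x y)\<^sup>2 \<le> q x x * q y y"
proof -
  have quad: "0 \<le> q x x - 2 * t * q x y + t\<^sup>2 * q y y" for t
  proof -
    have "x - t *\<^sub>R y \<in> W"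
      using W x y by (simp add: subspace_diff subspace_scale)
    then have "0 \<le> q (x - t *\<^sub>R y) (x - t *\<^sub>R y)" by (rule nonneg)
    also have "\<dots> = q x x - 2 * t * q x y + t\<^sup>2 * q y y"
      by (simp add: bilinear_lsub[OF q] bilinear_rsub[OF q] bilinear_lmul[OF q] bilinear_rmul[OF q]
          sym[of y x] power2_eq_square algebra_simps)
    finally show ?thesis .
  qed
  show ?thesis
  proof (cases "q y y = 0")
    case True
    have "q x y = 0"
    proof (rule ccontr)
      assume "q x y \<noteq> 0"
      then show False
        using quad[of "(q x x + 1) / (2 * q x y)"] True by simp
    qed
    then show ?thesis using True by simp
  next
    case False
    then have pos: "q y y > 0" using nonneg[OF y] by simp
    have "0 \<le> q x x - (q x y)\<^sup>2 / q y y"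
      using quad[of "q x y / q y y"] False by (simp add: power2_eq_square)
    then show ?thesis using pos by (simp add: field_simps)
  qed
qed

lemma subspace_sphere_attains_sup:
  fixes f :: "'a::euclidean_space \<Rightarrow> real"
  assumes W: "subspace W" "W \<noteq> {0}" and f: "continuous_on (sphere 0 1) f"
  obtains x where "x \<in> W" "norm x = 1" "\<And>y. y \<in> W \<Longrightarrow> norm y = 1 \<Longrightarrow> f y \<le> f x"
proof -
  obtain w where w: "w \<in> W" "w \<noteq> 0" using W subspace_0 by blast
  have "(1 / norm w) *\<^sub>R w \<in> W \<inter> sphere 0 1"
    using w W by (simp add: subspace_scale)
  moreover have "compact (W \<inter> sphere 0 1)"
    using W closed_subspace by (intro closed_Int_compact) auto
  moreover have "continuous_on (W \<inter> sphere 0 1) f"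
    using f by (rule continuous_on_subset) auto
  ultimately obtain x where "x \<in> W \<inter> sphere 0 1" "\<forall>y\<in>W \<inter> sphere 0 1. f y \<le> f x"
    using continuous_attains_sup[of "W \<inter> sphere 0 1" f] by blast
  then show ?thesis using that by (auto simp: dist_norm)
qed

lemma continuous_on_bilinear_linear:
  fixes B :: "'a::euclidean_space \<Rightarrow> 'a \<Rightarrow> real"
  assumes "bilinear B" "linear A"
  shows "continuous_on S (\<lambda>x. B x (A x))"
  by (rule bilinear_continuous_on_compose[OF continuous_on_id _ assms(1), simplified])
     (use assms(2) in \<open>simp add: linear_continuous_on linear_conv_bounded_linear\<close>)

text \<open>The constant is the minimum of the form on the unit sphere, attained by compactness;
  homogeneity does the rest.\<close>

lemma quadratic_form_ge_norm:
  fixes B :: "'a::euclidean_space \<Rightarrow> 'a \<Rightarrow> real"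
  assumes B: "bilinear B" and pos: "\<And>x. x \<noteq> 0 \<Longrightarrow> B x x > 0"
  obtains c where "c > 0" "\<And>x. c * (norm x)\<^sup>2 \<le> B x x"
proof -
  have "(UNIV :: 'a set) \<noteq> {0}"
    by (metis UNIV_I nonempty_Basis nonzero_Basis singletonD some_in_eq)
  moreover have "continuous_on (sphere 0 1) (\<lambda>x. - B x x)"
    using continuous_on_bilinear_linear[OF B linear_id] by (intro continuous_intros) simp
  ultimately obtain x where x: "norm x = 1" "\<And>y. norm y = 1 \<Longrightarrow> - B y y \<le> - B x x"
    using subspace_sphere_attains_sup[of UNIV "\<lambda>x. - B x x"] by auto
  have "B x x * (norm y)\<^sup>2 \<le> B y y" for y
  proof (cases "y = 0")
    case True
    then show ?thesis by (simp add: bilinear_lzero[OF B])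
  next
    case False
    have "B x x \<le> B ((1 / norm y) *\<^sub>R y) ((1 / norm y) *\<^sub>R y)"
      using x(2)[of "(1 / norm y) *\<^sub>R y"] False by simp
    also have "\<dots> = B y y / (norm y)\<^sup>2"
      by (simp add: bilinear_lmul[OF B] bilinear_rmul[OF B] power2_eq_square)
    finally show ?thesis using False by (simp add: field_simps)
  qed
  moreover have "B x x > 0" using x(1) by (intro pos) auto
  ultimately show ?thesis using that by blast
qed

text \<open>The vector maximises the Rayleigh quotient on the invariant subspace. That it is an
  eigenvector follows from Cauchy-Schwarz for a semidefinite form, without differentiating.\<close>

lemma selfadjoint_max_eigenvector:
  fixes B :: "'a::euclidean_space \<Rightarrow> 'a \<Rightarrow> real"
  assumes B: "bilinear B" and sym: "\<And>x y. B x y = B y x"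
    and pos: "\<And>x. x \<noteq> 0 \<Longrightarrow> B x x > 0"
    and A: "linear A" and sa: "\<And>x y. B x (A y) = B (A x) y"
    and W: "subspace W" "W \<noteq> {0}" and AW: "\<And>x. x \<in> W \<Longrightarrow> A x \<in> W"
  obtains x l where "x \<in> W" "x \<noteq> 0" "A x = l *\<^sub>R x" "\<And>z. z \<in> W \<Longrightarrow> B z (A z) \<le> l * B z z"
proof -
  have pos': "B x x > 0" if "norm x = 1" for x
    using that by (intro pos) auto
  have cont: "continuous_on (sphere 0 1) (\<lambda>x. B x (A x) / B x x)"
    using continuous_on_bilinear_linear[OF B A] continuous_on_bilinear_linear[OF B linear_id]
    by (intro continuous_on_divide) (auto dest!: pos')
  obtain x where x: "x \<in> W" "norm x = 1"
    and max: "\<And>y. y \<in> W \<Longrightarrow> norm y = 1 \<Longrightarrow> B y (A y) / B y y \<le> B x (A x) / B x x"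
    using subspace_sphere_attains_sup[OF W cont] by blast
  define l where "l = B x (A x) / B x x"
  have le: "B z (A z) \<le> l * B z z" if z: "z \<in> W" for z
  proof (cases "z = 0")
    case True
    then show ?thesis by (simp add: bilinear_lzero[OF B])
  next
    case False
    let ?y = "(1 / norm z) *\<^sub>R z"
    have "B ?y (A ?y) / B ?y ?y \<le> l"
      unfolding l_def using z False W(1) by (intro max) (auto simp: subspace_scale)
    also have "B ?y (A ?y) / B ?y ?y = B z (A z) / B z z"
      using False
      by (simp add: bilinear_lmul[OF B] bilinear_rmul[OF B] linear_cmul[OF A])
    finally show ?thesis using pos[OF False] by (simp add: field_simps)
  qed
  define q where "q = (\<lambda>u v. l * B u v - B u (A v))"
  have q: "bilinear q"
    unfolding bilinear_def q_def
    by (auto intro!: linearI simp: bilinear_ladd[OF B] bilinear_radd[OF B] bilinear_lmul[OF B]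
        bilinear_rmul[OF B] linear_add[OF A] linear_cmul[OF A] algebra_simps)
  have qsym: "q u v = q v u" for u v
    unfolding q_def using sa[of u v] sym[of u v] sym[of "A u" v] by simp
  let ?d = "l *\<^sub>R x - A x"
  \<comment> \<open>By the choice of \<open>l\<close>, \<open>q\<close> is semidefinite on
    \<open>W\<close> and vanishes at \<open>x\<close>, so \<open>x\<close> is
    \<open>q\<close>-orthogonal to all of \<open>W\<close>. Testing against the residual
    \<open>l *\<^sub>R x - A x\<close> gives the squared length of that residual.\<close>
  have d: "?d \<in> W" using x AW W(1) by (simp add: subspace_diff subspace_scale)
  have "(q x ?d)\<^sup>2 \<le> q x x * q ?d ?d"
    using le by (intro psd_form_Cauchy_Schwarz[OF q qsym W(1) _ x(1) d]) (simp add: q_def)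
  moreover have "q x x = 0" using pos'[OF x(2)] by (simp add: q_def l_def)
  ultimately have "q ?d x = 0" using qsym by simp
  then have "B ?d ?d = 0" by (simp add: q_def bilinear_rsub[OF B] bilinear_rmul[OF B])
  then have "?d = 0" using pos[of ?d] by force
  then have "A x = l *\<^sub>R x" by simp
  then show ?thesis using that[OF x(1) _ _ le] x(2) by force
qed

text \<open>Cauchy-Schwarz for the semidefinite form <u, A v>, applied to \<open>x\<close> and
  \<open>A x\<close>, gives |A x|^4 <= <x, A x> <A x, A A x> <= l |x|^2 l |A x|^2; one factor |A
  x|^2 cancels.\<close>

lemma psd_selfadjoint_norm_le:
  fixes B :: "'a::real_vector \<Rightarrow> 'a \<Rightarrow> real"
  assumes B: "bilinear B" and sym: "\<And>x y. B x y = B y x"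
    and pos: "\<And>x. 0 \<le> B x x"
    and A: "linear A" and sa: "\<And>x y. B x (A y) = B (A x) y"
    and W: "subspace W" and AW: "\<And>x. x \<in> W \<Longrightarrow> A x \<in> W"
    and ge: "\<And>x. x \<in> W \<Longrightarrow> 0 \<le> B x (A x)"
    and le: "\<And>x. x \<in> W \<Longrightarrow> B x (A x) \<le> l * B x x"
    and x: "x \<in> W"
  shows "B (A x) (A x) \<le> l\<^sup>2 * B x x"
proof (cases "B (A x) (A x) = 0")
  case True
  then show ?thesis using pos[of x] by simp
next
  case False
  define q where "q = (\<lambda>u v. B u (A v))"
  have q: "bilinear q"
    unfolding bilinear_def q_def
    by (auto intro!: linearI simp: bilinear_ladd[OF B] bilinear_radd[OF B] bilinear_lmul[OF B]
        bilinear_rmul[OF B] linear_add[OF A] linear_cmul[OF A] algebra_simps)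
  have qsym: "q u v = q v u" for u v
    unfolding q_def using sa[of u v] sym[of "A u" v] by simp
  have p: "B (A x) (A x) > 0" using False pos[of "A x"] by simp
  have "(q x (A x))\<^sup>2 \<le> q x x * q (A x) (A x)"
    using ge x AW by (intro psd_form_Cauchy_Schwarz[OF q qsym W]) (auto simp: q_def)
  also have "\<dots> \<le> (l * B x x) * (l * B (A x) (A x))"
    unfolding q_def using ge le x AW by (meson mult_mono order_trans)
  finally have "B (A x) (A x) * B (A x) (A x) \<le> (l\<^sup>2 * B x x) * B (A x) (A x)"
    by (simp add: q_def sa power2_eq_square mult_ac)
  then show ?thesis using p by simp
qed

text \<open>The sequence \<open>B (A\<^sup>k x) (A\<^sup>k x)\<close> is log-convex, so a first increase would force geometric growth.\<close>
lemma power_bounded_selfadjoint_contraction: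
  fixes B :: "'a::real_vector \<Rightarrow> 'a \<Rightarrow> real"
  assumes B: "bilinear B" and sym: "\<And>x y. B x y = B y x"
    and pos: "\<And>x. 0 \<le> B x x"
    and sa: "\<And>x y. B x (A y) = B (A x) y"
    and bd: "\<And>k. B ((A ^^ k) x) ((A ^^ k) x) \<le> C"
  shows "B (A x) (A x) \<le> B x x"
proof (rule ccontr)
  define u where "u k = B ((A ^^ k) x) ((A ^^ k) x)" for k
  have nonneg: "u k \<ge> 0" for k by (simp add: u_def pos)
  have conv: "(u (Suc k))\<^sup>2 \<le> u k * u (Suc (Suc k))" for k
  proof -
    have "u (Suc k) = B ((A ^^ k) x) ((A ^^ Suc (Suc k)) x)"
      by (simp add: u_def sa)
    then show ?thesis
      using psd_form_Cauchy_Schwarz[OF B sym subspace_UNIV pos] by (simp add: u_def)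
  qed
  assume "\<not> ?thesis"
  then have lt: "u 0 < u 1" by (simp add: u_def)
  have "u 0 > 0"
    using conv[of 0] lt nonneg[of 0] by (cases "u 0 = 0") auto
  define r where "r = u 1 / u 0"
  have r: "r > 1" using lt \<open>u 0 > 0\<close> by (simp add: r_def)
  have step: "u (Suc k) \<ge> r * u k \<and> u k > 0" for k
  proof (induction k)
    case 0
    then show ?case using \<open>u 0 > 0\<close> by (simp add: r_def)
  next
    case (Suc k)
    have p: "u (Suc k) > 0" using Suc r by (meson less_le_trans mult_pos_pos order.strict_trans zero_less_one)
    have "(r * u (Suc k)) * u k \<le> u (Suc k) * u (Suc k)"
      using mult_right_mono[of "r * u k" "u (Suc k)" "u (Suc k)"] Suc p by (simp add: mult_ac)
    also have "\<dots> \<le> u (Suc (Suc k)) * u k"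
      using conv[of k] by (simp add: power2_eq_square mult_ac)
    finally show ?case using Suc p by simp
  qed
  have geo: "u k \<ge> r ^ k * u 0" for k
  proof (induction k)
    case (Suc k)
    have "r ^ Suc k * u 0 \<le> r * u k" using Suc r by simp
    then show ?case using step[of k] by linarith
  qed simp
  obtain k where "C / u 0 < r ^ k" using real_arch_pow[OF r] by blast
  then have "C < r ^ k * u 0" using \<open>u 0 > 0\<close> by (simp add: field_simps)
  then show False using geo[of k] bd[of k] by (simp add: u_def)
qed

subsection \<open>Spectral theory of Hermitian matrices\<close>

lemma matrix_add_rdistrib: "(B + C) ** A = B ** A + C ** (A :: 'a::semiring_1^'n^'m)"
  by (simp add: matrix_matrix_mult_def vec_eq_iff distrib_right sum.distrib)

lemma matrix_scaleR_right: "A ** (k *\<^sub>R B) = k *\<^sub>R (A ** (B :: 'a::real_algebra_1^'n^'m))"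
  by (simp add: matrix_scalar_ac scalar_matrix_assoc)

lemma matrix_scaleR_left: "(k *\<^sub>R A) ** B = k *\<^sub>R (A ** (B :: 'a::real_algebra_1^'n^'m))"
  by (simp add: scalar_matrix_assoc)

lemma trace_scaleR: "trace (k *\<^sub>R A) = k *\<^sub>R trace (A :: 'a::real_algebra_1^'n^'n)"
  by (simp add: trace_def scaleR_sum_right)

lemma trace_sum: "trace (sum f I) = (\<Sum>i\<in>I. trace (f i :: 'a::comm_semiring_1^'n^'n))"
  by (induction I rule: infinite_finite_induct) (auto simp: trace_add trace_0[simplified])

lemma matrix_sum_ldistrib: "A ** sum f I = (\<Sum>i\<in>I. A ** (f i :: 'a::semiring_1^'n^'m))"
  by (induction I rule: infinite_finite_induct) (auto simp: matrix_add_ldistrib)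

lemma matrix_sum_rdistrib: "sum f I ** A = (\<Sum>i\<in>I. (f i :: 'a::semiring_1^'n^'m) ** A)"
  by (induction I rule: infinite_finite_induct) (auto simp: matrix_add_rdistrib)

lemma linear_matrix_sandwich: "linear (\<lambda>X. A ** X ** (B :: 'a::real_algebra_1^'n^'m))"
  by (intro linearI) (simp_all add: matrix_add_ldistrib matrix_add_rdistrib matrix_scaleR_right matrix_scaleR_left)

lemma cadj_nth [simp]: "cadj A $ i $ j = cnj (A $ j $ i)"
  by (simp add: cadj_def)

lemma cadj_cadj [simp]: "cadj (cadj A) = A"
  by (simp add: vec_eq_iff)

lemma cadj_mult: "cadj (A ** B) = cadj B ** cadj A"
  by (simp add: vec_eq_iff matrix_matrix_mult_def mult.commute)

lemma cadj_add: "cadj (A + B) = cadj A + cadj B"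
  by (simp add: vec_eq_iff)

lemma cadj_diff: "cadj (A - B) = cadj A - cadj B"
  by (simp add: vec_eq_iff)

lemma cadj_scaleR: "cadj (c *\<^sub>R A) = c *\<^sub>R cadj A"
  by (simp add: vec_eq_iff)

lemma cadj_sum: "cadj (sum f I) = (\<Sum>i\<in>I. cadj (f i))"
  by (simp add: vec_eq_iff)

lemma cadj_mat_1 [simp]: "cadj (mat 1) = mat 1"
  by (auto simp: vec_eq_iff mat_def)

lemma cscale_of_real: "cscale (complex_of_real c) A = c *\<^sub>R A"
  by (simp add: vec_eq_iff cscale_def scaleR_conv_of_real[where 'a=complex])

lemma cscale_mult_right: "A ** cscale c B = cscale c (A ** B)"
  by (simp add: vec_eq_iff cscale_def matrix_matrix_mult_def sum_distrib_left mult_ac)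

lemma cscale_mult_left: "cscale c A ** B = cscale c (A ** B)"
  by (simp add: vec_eq_iff cscale_def matrix_matrix_mult_def sum_distrib_left mult_ac)

lemma trace_cscale: "trace (cscale c A) = c * trace A"
  by (simp add: trace_def cscale_def sum_distrib_left)

lemma trace_cadj: "trace (cadj A) = cnj (trace A)"
  by (simp add: trace_def)

text \<open>Identifies the Euclidean inner product of the type with the real part of the
  Hilbert-Schmidt product, so that results on Euclidean spaces apply to matrices.\<close>

lemma inner_cmat: "inner A B = Re (trace (cadj A ** B))"
  unfolding trace_def matrix_matrix_mult_def inner_vec_def
  by (simp add: inner_complex_def Re_sum) (rule sum.swap)

text \<open>The complex inner product, conjugate-linear on the left. \<open>inner\<close> keeps only
  its real part, which is too weak to express unitarity or positivity.\<close>

definition cdot :: "complex^'d \<Rightarrow> complex^'d::finite \<Rightarrow> complex" where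
  "cdot x y = (\<Sum>i\<in>UNIV. cnj (x $ i) * y $ i)"

lemma Re_cdot: "Re (cdot x y) = inner x y"
  by (simp add: cdot_def inner_vec_def inner_complex_def)

lemma cdot_self: "cdot x x = complex_of_real ((norm x)\<^sup>2)"
proof (rule complex_eqI)
  show "Re (cdot x x) = Re (complex_of_real ((norm x)\<^sup>2))"
    by (simp add: Re_cdot power2_norm_eq_inner)
  show "Im (cdot x x) = Im (complex_of_real ((norm x)\<^sup>2))"
    by (simp add: cdot_def mult.commute)
qed

lemma cdot_cnj: "cdot y x = cnj (cdot x y)"
  by (simp add: cdot_def mult.commute)

lemma cdot_add_right: "cdot x (y + z) = cdot x y + cdot x z"
  by (simp add: cdot_def distrib_left sum.distrib)

lemma cdot_add_left: "cdot (x + y) z = cdot x z + cdot y z"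
  by (simp add: cdot_def distrib_right sum.distrib)

lemma cdot_scaleR_right: "cdot x (c *\<^sub>R y) = c *\<^sub>R cdot x y"
  by (simp add: cdot_def scaleR_sum_right)

lemma cdot_scaleR_left: "cdot (c *\<^sub>R x) y = c *\<^sub>R cdot x y"
  by (simp add: cdot_def scaleR_sum_right)

lemma cdot_matrix_right: "cdot x (A *v y) = cdot (cadj A *v x) y"
proof -
  have "cdot x (A *v y) = (\<Sum>i\<in>UNIV. \<Sum>j\<in>UNIV. cnj (x $ i) * (A $ i $ j * y $ j))"
    by (simp add: cdot_def matrix_vector_mult_def sum_distrib_left)
  also have "\<dots> = (\<Sum>j\<in>UNIV. \<Sum>i\<in>UNIV. cnj (x $ i) * (A $ i $ j * y $ j))"
    by (rule sum.swap)
  also have "\<dots> = cdot (cadj A *v x) y"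
    by (simp add: cdot_def matrix_vector_mult_def sum_distrib_left sum_distrib_right mult_ac)
  finally show ?thesis .
qed

lemma matrix_vector_scaleR_complex: "A *v (c *\<^sub>R x) = c *\<^sub>R (A *v (x :: complex^'n))"
  by (simp add: vec_eq_iff matrix_vector_mult_def scaleR_sum_right)

text \<open>Each new eigenvector is found on the orthogonal complement of the earlier ones, which a
  Hermitian matrix preserves. Indexing by the matrix index type lets the vectors become the columns
  of a unitary.\<close>

lemma hermitian_orthonormal_eigenvectors:
  fixes A :: "'d::finite cmat"
  assumes A: "hermitian A" and "finite J"
  shows "\<exists>v e. (\<forall>i\<in>J. A *v v i = e i *\<^sub>R v i) \<and>
    (\<forall>i\<in>J. \<forall>j\<in>J. cdot (v i) (v j) = (if i = (j::'d) then 1 else 0))"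
  using \<open>finite J\<close>
proof (induction J rule: finite_induct)
  case (insert k J)
  then obtain v e where v: "\<And>i. i \<in> J \<Longrightarrow> A *v v i = e i *\<^sub>R v i"
    and orth: "\<And>i j. i \<in> J \<Longrightarrow> j \<in> J \<Longrightarrow> cdot (v i) (v j) = (if i = j then 1 else 0)"
    by blast
  have sa: "cadj A = A" using A by (simp add: hermitian_def)
  define W where "W = {x. \<forall>i\<in>J. cdot (v i) x = 0}"
  have W: "subspace W"
    by (auto simp: subspace_def W_def cdot_add_right cdot_scaleR_right) (simp add: cdot_def)
  have W0: "W \<noteq> {0}"
  proof -
    \<comment> \<open>The complement is nonzero by a dimension count: \<open>f\<close> has zero
      \<open>k\<close>-th entry, so it misses the all-ones vector; a linear self-map that is not
      onto has a nonzero kernel, and the kernel lies in \<open>W\<close>.\<close>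
    define f where "f x = (\<chi> i. if i \<in> J then cdot (v i) x else 0)" for x
    have "linear f"
      by (intro linearI) (auto simp: f_def vec_eq_iff cdot_add_right cdot_scaleR_right)
    moreover have "f x \<noteq> (\<chi> i. 1)" for x
      using insert.hyps by (auto simp: f_def vec_eq_iff)
    then have "\<not> surj f" by (metis surjD)
    ultimately have "\<not> inj f" using linear_injective_imp_surjective by blast
    then obtain x where "f x = 0" "x \<noteq> 0"
      using linear_injective_0[OF \<open>linear f\<close>] by blast
    moreover from this have "cdot (v i) x = 0" if "i \<in> J" for i
      using that by (auto simp: f_def vec_eq_iff dest: spec[of _ i])
    ultimately show ?thesis by (auto simp: W_def)
  qed
  have AW: "A *v x \<in> W" if "x \<in> W" for x
    using that v by (auto simp: W_def cdot_matrix_right sa cdot_scaleR_left)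
  have "bilinear (inner :: complex^'d \<Rightarrow> _)"
    by (simp add: bilinear_conv_bounded_bilinear bounded_bilinear_inner)
  moreover have "inner x (A *v y) = inner (A *v x) y" for x y
    using cdot_matrix_right[of x A y] by (simp add: sa flip: Re_cdot)
  ultimately obtain x l where x: "x \<in> W" "x \<noteq> 0" "A *v x = l *\<^sub>R x"
    using selfadjoint_max_eigenvector[of inner "(*v) A" W] W W0 AW
    by (metis inner_commute inner_gt_zero_iff matrix_vector_mul_linear)
  define y where "y = (1 / norm x) *\<^sub>R x"
  have y: "A *v y = l *\<^sub>R y" "cdot y y = 1" "\<And>i. i \<in> J \<Longrightarrow> cdot (v i) y = 0"
    using x by (auto simp: y_def matrix_vector_scaleR_complex cdot_self W_def cdot_scaleR_right)
  moreover have "cdot y (v i) = 0" if "i \<in> J" for i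
    using y(3)[OF that] cdot_cnj[of y "v i"] by simp
  ultimately show ?case
    using v orth insert.hyps
    by (intro exI[of _ "v(k := y)"] exI[of _ "e(k := l)"]) auto
qed auto

text \<open>The normal form of a Hermitian matrix. For a fixed unitary \<open>V\<close>, products,
  traces, powers and functional calculus become pointwise operations on \<open>d\<close>.\<close>

definition udiag :: "'d cmat \<Rightarrow> ('d \<Rightarrow> real) \<Rightarrow> 'd::finite cmat" where
  "udiag V d = V ** diagm (\<lambda>i. complex_of_real (d i)) ** cadj V"

lemma mult_diagm_nth: "(A ** diagm d) $ i $ j = A $ i $ j * d j"
  by (simp add: matrix_matrix_mult_def diagm_def if_distrib sum.delta cong: if_cong)

lemma diagm_mult_nth: "(diagm d ** A) $ i $ j = d i * A $ i $ j"
  by (simp add: matrix_matrix_mult_def diagm_def if_distrib[of "\<lambda>x. x * _"] sum.delta cong: if_cong)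

lemma hermitian_udiag_exists:
  fixes A :: "'d::finite cmat"
  assumes "hermitian A"
  obtains V d where "unitary V" "A = udiag V d"
proof -
  obtain v e where v: "\<And>i. A *v v i = e i *\<^sub>R v i"
    and orth: "\<And>i j :: 'd. cdot (v i) (v j) = (if i = j then 1 else 0)"
    using hermitian_orthonormal_eigenvectors[OF assms finite_class.finite_UNIV] by (metis UNIV_I)
  define V where "V = (\<chi> i j. v j $ i)"
  have "cadj V ** V = mat 1"
    using orth by (simp add: vec_eq_iff V_def matrix_matrix_mult_def mat_def cdot_def)
  then have V: "unitary V"
    using matrix_left_right_inverse by (auto simp: unitary_def)
  have "A ** V = V ** diagm (\<lambda>i. complex_of_real (e i))"
  proof -
    have "(A ** V) $ i $ j = (A *v v j) $ i" for i j
      by (simp add: V_def matrix_matrix_mult_def matrix_vector_mult_def)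
    then show ?thesis
      by (simp add: vec_eq_iff mult_diagm_nth v) (simp add: V_def scaleR_conv_of_real[where 'a=complex] mult.commute)
  qed
  then have "A = udiag V e"
    using V by (metis matrix_mul_assoc matrix_mul_rid udiag_def unitary_def)
  with V that show ?thesis by blast
qed

text \<open>\<open>hfun\<close> picks an arbitrary diagonalisation, so the point is independence of
  that choice.\<close>

lemma hfun_udiag:
  assumes V: "unitary V"
  shows "hfun f (udiag V d) = udiag V (\<lambda>i. f (d i))"
  unfolding hfun_def
proof (rule some_equality)
  show "\<exists>U e. unitary U \<and> udiag V d = U ** diagm (\<lambda>i. complex_of_real (e i)) ** cadj U \<and>
       udiag V (\<lambda>i. f (d i)) = U ** diagm (\<lambda>i. complex_of_real (f (e i))) ** cadj U"
    using V by (auto simp: udiag_def)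
next
  fix B assume "\<exists>U e. unitary U \<and> udiag V d = U ** diagm (\<lambda>i. complex_of_real (e i)) ** cadj U \<and>
       B = U ** diagm (\<lambda>i. complex_of_real (f (e i))) ** cadj U"
  then obtain U e where U: "unitary U" and eq: "udiag V d = udiag U e"
    and B: "B = udiag U (\<lambda>i. f (e i))"
    by (auto simp: udiag_def)
  let ?D = "\<lambda>d. diagm (\<lambda>i. complex_of_real (d i))"
  \<comment> \<open>The change of basis intertwines the two diagonal matrices. Hence a nonzero entry
    of \<open>W\<close> forces the two eigenvalues, and so their images under \<open>f\<close>, to
    agree, and \<open>W\<close> also intertwines the transformed diagonals.\<close>
  define W where "W = cadj U ** V"
  have conj: "cadj U ** udiag V d' ** V = W ** ?D d'" for d'
    using V by (simp add: W_def udiag_def unitary_def matrix_mul_assoc[symmetric])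
  have conj': "cadj U ** udiag U e' ** V = ?D e' ** W" for e'
    using U by (simp add: W_def udiag_def unitary_def matrix_mul_assoc)
  have inj: "X = Y" if "cadj U ** X ** V = cadj U ** Y ** V" for X Y
  proof -
    have "U ** (cadj U ** X ** V) ** cadj V = U ** (cadj U ** Y ** V) ** cadj V"
      using that by simp
    then show ?thesis
      using U V by (metis matrix_mul_assoc matrix_mul_lid matrix_mul_rid unitary_def)
  qed
  have "W ** ?D d = ?D e ** W"
    using conj[of d] conj'[of e] eq by simp
  then have *: "W $ i $ j * d j = e i * W $ i $ j" for i j
    by (metis mult_diagm_nth diagm_mult_nth)
  have "d j = e i" if "W $ i $ j \<noteq> 0" for i j
    using *[of i j] that by (metis mult.commute mult_right_cancel of_real_eq_iff)
  then have "W $ i $ j * f (d j) = f (e i) * W $ i $ j" for i j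
    by (metis mult.commute mult_zero_left)
  then have "W ** ?D (\<lambda>i. f (d i)) = ?D (\<lambda>i. f (e i)) ** W"
    by (simp add: vec_eq_iff mult_diagm_nth diagm_mult_nth)
  then show "B = udiag V (\<lambda>i. f (d i))"
    unfolding B by - (rule inj, simp only: conj conj')
qed

lemma cadj_udiag: "cadj (udiag V d) = udiag V d"
proof -
  have "cadj (diagm (\<lambda>i. complex_of_real (d i))) = diagm (\<lambda>i. complex_of_real (d i))"
    by (auto simp: vec_eq_iff diagm_def)
  then show ?thesis by (simp add: udiag_def cadj_mult matrix_mul_assoc)
qed

lemma udiag_mult:
  assumes "unitary V"
  shows "udiag V d ** udiag V e = udiag V (\<lambda>i. d i * e i)"
proof -
  let ?D = "\<lambda>d. diagm (\<lambda>i. complex_of_real (d i))"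
  have "udiag V d ** udiag V e = V ** ?D d ** (cadj V ** V) ** ?D e ** cadj V"
    by (simp add: udiag_def matrix_mul_assoc)
  also have "\<dots> = V ** (?D d ** ?D e) ** cadj V"
    using assms by (simp add: unitary_def matrix_mul_assoc)
  also have "?D d ** ?D e = ?D (\<lambda>i. d i * e i)"
    by (simp add: vec_eq_iff mult_diagm_nth) (simp add: diagm_def)
  finally show ?thesis by (simp add: udiag_def)
qed

lemma udiag_add: "udiag V d + udiag V e = udiag V (\<lambda>i. d i + e i)"
proof -
  have "diagm (\<lambda>i. complex_of_real (d i + e i)) = diagm (\<lambda>i. complex_of_real (d i)) + diagm (\<lambda>i. complex_of_real (e i))"
    by (simp add: vec_eq_iff diagm_def)
  then show ?thesis by (simp add: udiag_def matrix_add_ldistrib matrix_add_rdistrib)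
qed

lemma udiag_scaleR: "c *\<^sub>R udiag V d = udiag V (\<lambda>i. c * d i)"
proof -
  have "diagm (\<lambda>i. complex_of_real (c * d i)) = c *\<^sub>R diagm (\<lambda>i. complex_of_real (d i))"
    by (simp add: vec_eq_iff diagm_def scaleR_conv_of_real[where 'a=complex])
  then show ?thesis by (simp add: udiag_def matrix_scaleR_left matrix_scaleR_right)
qed

lemma udiag_1:
  fixes V :: "'d::finite cmat"
  assumes "unitary V"
  shows "udiag V (\<lambda>i. 1) = mat 1"
proof -
  have "diagm (\<lambda>i. 1) = (mat 1 :: 'd cmat)" by (simp add: vec_eq_iff diagm_def mat_def)
  then show ?thesis using assms by (simp add: udiag_def unitary_def)
qed

lemma trace_udiag:
  assumes "unitary V"
  shows "trace (udiag V d) = complex_of_real (\<Sum>i\<in>UNIV. d i)"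
proof -
  let ?D = "diagm (\<lambda>i. complex_of_real (d i))"
  have "trace (udiag V d) = trace (cadj V ** (V ** ?D))"
    unfolding udiag_def by (rule trace_mul_sym)
  also have "\<dots> = trace ?D"
    using assms by (simp add: matrix_mul_assoc unitary_def)
  finally show ?thesis by (simp add: trace_def diagm_def)
qed

lemma cdot_udiag: "cdot x (udiag V d *v x) = complex_of_real (\<Sum>i\<in>UNIV. d i * (cmod ((cadj V *v x) $ i))\<^sup>2)"
proof -
  let ?D = "diagm (\<lambda>i. complex_of_real (d i))"
  let ?y = "cadj V *v x"
  have "cdot x (udiag V d *v x) = cdot x (V *v (?D *v ?y))"
    by (simp add: udiag_def matrix_vector_mul_assoc matrix_mul_assoc)
  also have "\<dots> = cdot ?y (?D *v ?y)" by (rule cdot_matrix_right)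
  also have "\<dots> = (\<Sum>i\<in>UNIV. cnj (?y $ i) * (d i * ?y $ i))"
  proof -
    have "(?D *v y) $ i = d i * y $ i" for y i
      by (simp add: matrix_vector_mult_def diagm_def if_distrib[of "\<lambda>x. x * _"] cong: if_cong)
    then show ?thesis by (simp add: cdot_def)
  qed
  also have "\<dots> = complex_of_real (\<Sum>i\<in>UNIV. d i * (cmod (?y $ i))\<^sup>2)"
    unfolding of_real_sum
    by (intro sum.cong) (auto simp: complex_norm_square mult_ac simp flip: of_real_power)
  finally show ?thesis .
qed

section \<open>Positive semidefinite matrices and the trace norm\<close>

lemma psd_altdef: "psd A \<longleftrightarrow> (\<forall>x. Im (cdot x (A *v x)) = 0 \<and> 0 \<le> Re (cdot x (A *v x)))"
  by (simp add: psd_def cdot_def Let_def)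

lemma psd_udiag: "(\<And>i. 0 \<le> d i) \<Longrightarrow> psd (udiag V d)"
  unfolding psd_altdef cdot_udiag by (simp add: sum_nonneg)

lemma psd_udiagD:
  assumes "unitary V" "psd (udiag V d)"
  shows "0 \<le> d i"
proof -
  have "cadj V *v (V *v axis i 1) = axis i 1"
    using assms by (simp add: matrix_vector_mul_assoc unitary_def)
  then have "0 \<le> (\<Sum>j\<in>UNIV. d j * (cmod (axis i 1 $ j))\<^sup>2)"
    using assms(2) unfolding psd_altdef cdot_udiag by (metis Re_complex_of_real)
  also have "\<dots> = (\<Sum>j\<in>UNIV. if j = i then d j else 0)"
    by (intro sum.cong) (auto simp: axis_def)
  finally show ?thesis by simp
qed

lemma cdot_axis: "cdot (axis i a) (A *v axis j b) = cnj a * (A $ i $ j * b)"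
proof -
  have "(A *v axis j b) $ k = A $ k $ j * b" for k
    by (simp add: matrix_vector_mult_def axis_def if_distrib cong: if_cong)
  then show ?thesis
    by (simp add: cdot_def axis_def if_distrib[of cnj] if_distrib[of "\<lambda>x. x * _"] cong: if_cong)
qed

text \<open>Polarisation: reality of the quadratic form at \<open>x + y\<close> makes the cross
  terms sum to a real number. Basis vectors with entries 1 and 1 give the imaginary parts of the
  matrix entries, with entries 1 and i the real parts.\<close>

lemma psd_hermitian:
  assumes "psd A"
  shows "hermitian A"
proof -
  have real: "Im (cdot x (A *v x)) = 0" for x
    using assms by (simp add: psd_altdef)
  have cross: "Im (cdot x (A *v y) + cdot y (A *v x)) = 0" for x y
    using real[of "x + y"] real[of x] real[of y]
    by (simp add: matrix_vector_right_distrib cdot_add_right cdot_add_left)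
  have "cnj (A $ j $ i) = A $ i $ j" for i j
  proof (rule complex_eqI)
    show "Re (cnj (A $ j $ i)) = Re (A $ i $ j)"
      using cross[of "axis i 1" "axis j \<i>"] unfolding cdot_axis by simp
    show "Im (cnj (A $ j $ i)) = Im (A $ i $ j)"
      using cross[of "axis i 1" "axis j 1"] unfolding cdot_axis by simp
  qed
  then show ?thesis by (simp add: hermitian_def vec_eq_iff)
qed

lemma psd_udiag_exists:
  assumes "psd A"
  obtains V d where "unitary V" "A = udiag V d" "\<And>i. 0 \<le> d i"
proof -
  obtain V d where V: "unitary V" "A = udiag V d"
    using hermitian_udiag_exists[OF psd_hermitian[OF assms]] .
  with assms that psd_udiagD[of V d] show ?thesis by blast
qed

lemma psd_add: "psd A \<Longrightarrow> psd B \<Longrightarrow> psd (A + B)"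
  by (simp add: psd_altdef matrix_vector_mult_add_rdistrib cdot_add_right)

lemma psd_0 [simp]: "psd 0"
  by (simp add: psd_altdef cdot_def)

lemma psd_sum: "(\<And>i. i \<in> I \<Longrightarrow> psd (f i)) \<Longrightarrow> psd (sum f I)"
  by (induction I rule: infinite_finite_induct) (auto simp: psd_add)

lemma psd_sandwich: "psd A \<Longrightarrow> psd (K ** A ** cadj K)"
  unfolding psd_altdef
  by (simp add: matrix_vector_mul_assoc[symmetric] cdot_matrix_right[of _ K])

text \<open>The last inequality compares the l2 norm of the eigenvalues with their l1 norm. It lets
  a conserved trace control the norm.\<close>

lemma psd_trace:
  assumes "psd A"
  shows "trace A = complex_of_real (Re (trace A))" "0 \<le> Re (trace A)" "norm A \<le> Re (trace A)"
proof -
  obtain V d where V: "unitary V" "A = udiag V d" and d: "\<And>i. 0 \<le> d i"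
    using psd_udiag_exists[OF assms] by blast
  show "trace A = complex_of_real (Re (trace A))" "0 \<le> Re (trace A)"
    by (auto simp: V trace_udiag d sum_nonneg)
  have "(norm A)\<^sup>2 = (\<Sum>i\<in>UNIV. d i * d i)"
    by (simp add: power2_norm_eq_inner inner_cmat V cadj_udiag udiag_mult trace_udiag)
  then have "norm A = L2_set d UNIV"
    by (simp add: L2_set_def power2_eq_square real_sqrt_unique)
  also have "\<dots> \<le> (\<Sum>i\<in>UNIV. d i)" using d by (intro L2_set_le_sum)
  finally show "norm A \<le> Re (trace A)" by (simp add: V trace_udiag)
qed

lemma trace_norm_udiag:
  assumes "unitary V"
  shows "trace_norm (udiag V d) = (\<Sum>i\<in>UNIV. \<bar>d i\<bar>)"
  using assms by (simp add: trace_norm_def cadj_udiag udiag_mult hfun_udiag trace_udiag)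

text \<open>Each eigenvalue is at most the Frobenius norm in modulus. This crude comparison suffices
  to transfer convergence to the trace norm.\<close>

lemma trace_norm_hermitian_le:
  fixes A :: "'d::finite cmat"
  assumes "hermitian A"
  shows "trace_norm A \<le> CARD('d) * norm A"
proof -
  obtain V d where V: "unitary V" "A = udiag V d"
    using hermitian_udiag_exists[OF assms] .
  have norm: "norm A = L2_set d UNIV"
    using V by (simp add: norm_eq_sqrt_inner inner_cmat cadj_udiag udiag_mult trace_udiag L2_set_def power2_eq_square)
  have "\<bar>d i\<bar> \<le> norm A" for i
    unfolding norm L2_set_def by (intro real_le_rsqrt) (auto intro!: member_le_sum)
  then have "(\<Sum>i\<in>UNIV. \<bar>d i\<bar>) \<le> (\<Sum>i\<in>(UNIV::'d set). norm A)"
    by (intro sum_mono)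
  then show ?thesis using V by (simp add: trace_norm_udiag)
qed

text \<open>The witness is the absolute value of \<open>A\<close>. Dominating \<open>A\<close> by it
  lets monotone functionals be estimated by a trace norm.\<close>

lemma hermitian_abs_decomposition:
  assumes "hermitian A"
  obtains P where "psd P" "psd (P - A)" "Re (trace P) = trace_norm A"
proof -
  obtain V d where V: "unitary V" "A = udiag V d"
    using hermitian_udiag_exists[OF assms] .
  let ?P = "udiag V (\<lambda>i. \<bar>d i\<bar>)"
  have "?P - A = ?P + (- 1) *\<^sub>R A" by simp
  also have "\<dots> = udiag V (\<lambda>i. \<bar>d i\<bar> - d i)"
    unfolding V(2) udiag_scaleR udiag_add by simp
  finally have "psd (?P - A)" by (simp add: psd_udiag)
  then show ?thesis
    using that[of ?P] V by (simp add: psd_udiag trace_udiag trace_norm_udiag)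
qed

subsection \<open>Channels and weighted Kraus maps\<close>

text \<open>A common form for channels, the measurement channel and \<open>meas_hat\<close>. The
  real weights may be negative, and the Hilbert-Schmidt adjoint is again of this form.\<close>

definition wkraus :: "'i set \<Rightarrow> ('i \<Rightarrow> real) \<Rightarrow> ('i \<Rightarrow> 'd cmat) \<Rightarrow> 'd::finite cmat \<Rightarrow> 'd cmat" where
  "wkraus I c F X = (\<Sum>i\<in>I. c i *\<^sub>R (F i ** X ** cadj (F i)))"

lemma linear_wkraus: "linear (wkraus I c F)"
  unfolding wkraus_def by (intro linear_compose_sum ballI linear_compose_scale_right linear_matrix_sandwich)

lemma wkraus_cadj: "wkraus I c F (cadj X) = cadj (wkraus I c F X)"
  by (simp add: wkraus_def cadj_sum cadj_scaleR cadj_mult matrix_mul_assoc)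

lemma cscale_sum: "cscale z (sum f I) = (\<Sum>i\<in>I. cscale z (f i))"
  by (simp add: vec_eq_iff cscale_def sum_distrib_left)

lemma cscale_scaleR: "cscale z (c *\<^sub>R A) = c *\<^sub>R cscale z A"
  by (simp add: vec_eq_iff cscale_def)

lemma wkraus_cscale: "wkraus I c F (cscale z X) = cscale z (wkraus I c F X)"
  by (simp add: wkraus_def cscale_sum cscale_scaleR cscale_mult_left cscale_mult_right)

lemma scaleR_matrix_vector_complex: "(c *\<^sub>R A) *v x = c *\<^sub>R (A *v (x :: complex^'n))"
  by (simp add: vec_eq_iff matrix_vector_mult_def scaleR_sum_right)

lemma psd_scaleR: "0 \<le> c \<Longrightarrow> psd A \<Longrightarrow> psd (c *\<^sub>R A)"
  by (simp add: psd_altdef cdot_scaleR_right scaleR_matrix_vector_complex)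

lemma psd_wkraus: "(\<And>i. i \<in> I \<Longrightarrow> 0 \<le> c i) \<Longrightarrow> psd X \<Longrightarrow> psd (wkraus I c F X)"
  unfolding wkraus_def by (intro psd_sum psd_scaleR psd_sandwich)

lemma trace_wkraus_adjoint:
  "trace (cadj A ** wkraus I c F B) = trace (cadj (wkraus I c (\<lambda>i. cadj (F i)) A) ** B)"
proof -
  have "trace (cadj A ** (F i ** B ** cadj (F i))) = trace (cadj (F i) ** cadj A ** F i ** B)" for i
    using trace_mul_sym[of "cadj A ** F i ** B" "cadj (F i)"] by (simp add: matrix_mul_assoc)
  then show ?thesis
    by (simp add: wkraus_def cadj_sum cadj_scaleR cadj_mult matrix_sum_ldistrib matrix_sum_rdistrib
        matrix_scaleR_left matrix_scaleR_right trace_sum trace_scaleR matrix_mul_assoc)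
qed

lemma hs_adj_wkraus: "hs_adj (wkraus I c F) = wkraus I c (\<lambda>i. cadj (F i))"
  unfolding hs_adj_def
proof (rule some_equality)
  show "\<forall>A B. trace (cadj A ** wkraus I c F B) = trace (cadj (wkraus I c (\<lambda>i. cadj (F i)) A) ** B)"
    by (simp add: trace_wkraus_adjoint)
next
  fix S assume S: "\<forall>A B. trace (cadj A ** wkraus I c F B) = trace (cadj (S A) ** B)"
  have "inner (S A) B = inner (wkraus I c (\<lambda>i. cadj (F i)) A) B" for A B
    using S by (simp add: inner_cmat flip: trace_wkraus_adjoint)
  then show "S = wkraus I c (\<lambda>i. cadj (F i))"
    using vector_eq_rdot by blast
qed

lemma inner_wkraus: "inner A (wkraus I c F B) = inner (hs_adj (wkraus I c F) A) B"
  by (simp add: inner_cmat trace_wkraus_adjoint hs_adj_wkraus)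

lemma trace_wkraus:
  assumes "(\<Sum>i\<in>I. cadj (F i) ** F i) = mat 1"
  shows "trace (wkraus I (\<lambda>_. 1) F X) = trace X"
proof -
  have "wkraus I (\<lambda>_. 1) (\<lambda>i. cadj (F i)) (mat 1) = mat 1"
    using assms by (simp add: wkraus_def)
  then show ?thesis
    using trace_wkraus_adjoint[of "mat 1" I "\<lambda>_. 1" F X] by simp
qed

lemma channel_wkraus:
  assumes "is_channel T"
  obtains m :: nat and F where "T = wkraus {..<m} (\<lambda>_. 1) F" "(\<Sum>i<m. cadj (F i) ** F i) = mat 1"
proof -
  obtain Ks where T: "\<And>X. T X = sum_list (map (\<lambda>K. K ** X ** cadj K) Ks)"
    and Ks: "sum_list (map (\<lambda>K. cadj K ** K) Ks) = mat 1"
    using assms by (auto simp: is_channel_def)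
  have "T = wkraus {..<length Ks} (\<lambda>_. 1) (\<lambda>i. Ks ! i)"
    by (rule ext) (simp add: T wkraus_def sum_list_sum_nth atLeast0LessThan)
  moreover have "(\<Sum>i<length Ks. cadj (Ks ! i) ** Ks ! i) = mat 1"
    using Ks by (simp add: sum_list_sum_nth atLeast0LessThan)
  ultimately show ?thesis using that by blast
qed

lemma meas_channel_wkraus: "meas_channel U Ob = wkraus U (\<lambda>_. 1) Ob"
  by (rule ext) (simp add: meas_channel_def wkraus_def)

lemma trace_meas_channel: "is_measurement U Ob \<Longrightarrow> trace (meas_channel U Ob X) = trace X"
  unfolding meas_channel_wkraus is_measurement_def by (rule trace_wkraus) simp

lemma meas_hat_wkraus: "meas_hat U Ob \<rho> = wkraus U (\<lambda>u. u - meas_E U Ob \<rho>) Ob"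
  by (rule ext) (simp add: meas_hat_def wkraus_def)

text \<open>Unlike a Kraus representation, these properties pass to powers at once.
  \<open>linear\<close> means real-linear, so complex scalars and adjoints are listed
  separately.\<close>

definition positive_tp :: "('d::finite cmat \<Rightarrow> 'd cmat) \<Rightarrow> bool" where
  "positive_tp T \<longleftrightarrow> linear T \<and> (\<forall>c X. T (cscale c X) = cscale c (T X)) \<and>
     (\<forall>X. T (cadj X) = cadj (T X)) \<and> (\<forall>X. psd X \<longrightarrow> psd (T X)) \<and> (\<forall>X. trace (T X) = trace X)"

lemma positive_tp_wkraus:
  assumes "(\<Sum>i\<in>I. cadj (F i) ** F i) = mat 1"
  shows "positive_tp (wkraus I (\<lambda>_. 1) F)"
  using assms by (simp add: positive_tp_def linear_wkraus wkraus_cscale wkraus_cadj psd_wkraus trace_wkraus)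

lemma positive_tp_funpow: "positive_tp T \<Longrightarrow> positive_tp (T ^^ k)"
proof (induction k)
  case 0
  show ?case by (simp add: positive_tp_def linear_id[unfolded id_def] id_def)
next
  case (Suc k)
  then show ?case
    using linear_compose[of "T ^^ k" T] by (simp add: positive_tp_def o_def)
qed

lemma positive_tp_is_state: "positive_tp T \<Longrightarrow> is_state \<sigma> \<Longrightarrow> is_state (T \<sigma>)"
  by (simp add: positive_tp_def is_state_def)

section \<open>Bounded orbits of positive trace-preserving maps\<close>

lemma norm_cscale_ii: "norm (cscale \<i> A) = norm A"
  by (simp add: norm_vec_def cscale_def L2_set_def norm_mult)

lemma hermitian_cartesian_decomposition:
  obtains A B where "hermitian A" "hermitian B" "Z = A + cscale \<i> B"
    "A = (1/2) *\<^sub>R (Z + cadj Z)" "B = cscale (- \<i> / 2) (Z - cadj Z)"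
proof -
  have "hermitian ((1/2) *\<^sub>R (Z + cadj Z))"
    by (simp add: hermitian_def cadj_scaleR cadj_add add.commute)
  moreover have "hermitian (cscale (- \<i> / 2) (Z - cadj Z))"
    by (simp add: hermitian_def vec_eq_iff cscale_def algebra_simps)
  moreover have "Z = (1/2) *\<^sub>R (Z + cadj Z) + cscale \<i> (cscale (- \<i> / 2) (Z - cadj Z))"
    by (simp add: vec_eq_iff cscale_def scaleR_conv_of_real[where 'a=complex] field_simps)
  ultimately show ?thesis using that by blast
qed

text \<open>On a positive semidefinite input the norm stays below the conserved trace. A Hermitian
  input is a difference of two such matrices, and a general one is reduced to its Hermitian and
  anti-Hermitian parts.\<close>

lemma positive_tp_orbit_bounded:
  assumes T: "positive_tp T"
  obtains C where "\<And>k. norm ((T ^^ k) Z) \<le> C"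
proof -
  have psd: "norm ((T ^^ k) P) \<le> Re (trace P)" if "psd P" for k P
    using positive_tp_funpow[OF T, of k] psd_trace(3)[of "(T ^^ k) P"] that by (simp add: positive_tp_def)
  have herm: "\<exists>C. \<forall>k. norm ((T ^^ k) A) \<le> C" if A: "hermitian A" for A
  proof -
    obtain P where P: "psd P" "psd (P - A)"
      using hermitian_abs_decomposition[OF A] by blast
    have "norm ((T ^^ k) A) \<le> Re (trace P) + Re (trace (P - A))" for k
    proof -
      have "(T ^^ k) A = (T ^^ k) P - (T ^^ k) (P - A)"
        using positive_tp_funpow[OF T, of k] by (simp add: positive_tp_def linear_diff)
      then show ?thesis
        using psd[OF P(1), of k] psd[OF P(2), of k] norm_triangle_ineq4[of "(T ^^ k) P" "(T ^^ k) (P - A)"]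
        by simp
    qed
    then show ?thesis by blast
  qed
  obtain A B where AB: "hermitian A" "hermitian B" "Z = A + cscale \<i> B"
    using hermitian_cartesian_decomposition .
  obtain C D where C: "\<And>k. norm ((T ^^ k) A) \<le> C" and D: "\<And>k. norm ((T ^^ k) B) \<le> D"
    using herm AB by metis
  have "norm ((T ^^ k) Z) \<le> C + D" for k
  proof -
    have "(T ^^ k) Z = (T ^^ k) A + cscale \<i> ((T ^^ k) B)"
      using positive_tp_funpow[OF T, of k] unfolding AB(3) by (simp add: positive_tp_def linear_add)
    then show ?thesis
      using norm_triangle_ineq[of "(T ^^ k) A" "cscale \<i> ((T ^^ k) B)"] C[of k] D[of k]
      by (simp add: norm_cscale_ii)
  qed
  then show ?thesis using that by blast
qed

text \<open>All that is used later about the Gibbs state: it is diagonalisable with strictly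
  positive weights summing to 1.\<close>

lemma gibbs_udiag:
  assumes "hermitian H"
  obtains V p where "unitary V" "gibbs \<beta> H = udiag V p" "\<And>i. 0 < p i" "(\<Sum>i\<in>UNIV. p i) = 1"
proof -
  have "hermitian (- (\<beta> *\<^sub>R H))"
    using assms cadj_scaleR[of "- \<beta>" H] by (simp add: hermitian_def)
  then obtain V d where V: "unitary V" "- (\<beta> *\<^sub>R H) = udiag V d"
    by (rule hermitian_udiag_exists)
  define Z where "Z = (\<Sum>i\<in>UNIV. exp (d i))"
  have Z: "Z > 0" unfolding Z_def by (intro sum_pos) auto
  have "gibbs \<beta> H = udiag V (\<lambda>i. 1 / Z * exp (d i))"
    using V by (simp add: gibbs_def Let_def mexp_def hfun_udiag trace_udiag Z_def udiag_scaleR)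
  moreover have "(\<Sum>i\<in>UNIV. 1 / Z * exp (d i)) = 1"
    using Z by (simp add: sum_distrib_left[symmetric] sum_divide_distrib[symmetric] Z_def)
  moreover have "0 < 1 / Z * exp (d i)" for i using Z by simp
  ultimately show ?thesis using that V(1) by blast
qed

subsection \<open>Detailed balance with respect to a faithful state\<close>

locale faithful_state =
  fixes V :: "'d::finite cmat" and p :: "'d \<Rightarrow> real" and \<rho> :: "'d cmat" and s :: real
  assumes V: "unitary V" and rho: "\<rho> = udiag V p" and p_pos: "\<And>i. 0 < p i"
    and p_sum: "(\<Sum>i\<in>UNIV. p i) = 1"
begin

text \<open>Carries observables to state-like matrices: it is bijective, sends the identity to
  \<rho>, and sends observables orthogonal to the identity to traceless matrices.\<close>

definition wt :: "'d cmat \<Rightarrow> 'd cmat" where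
  "wt X = mpow \<rho> (1 - s) ** X ** mpow \<rho> s"

text \<open>The real part of \<open>sinner\<close>: a real inner product, so the results on
  self-adjoint maps over the reals apply.\<close>

definition form :: "'d cmat \<Rightarrow> 'd cmat \<Rightarrow> real" where
  "form A B = inner A (wt B)"

section \<open>Powers of the state and the weighted inner product\<close>

lemma mpow_rho: "mpow \<rho> t = udiag V (\<lambda>i. p i powr t)"
  by (simp add: mpow_def rho hfun_udiag V)

lemma mpow_add: "mpow \<rho> t ** mpow \<rho> u = mpow \<rho> (t + u)"
  by (simp add: mpow_rho udiag_mult V powr_add)

lemma mpow_0: "mpow \<rho> 0 = mat 1"
  using p_pos by (simp add: mpow_rho udiag_1 V less_imp_neq[symmetric])

lemma mpow_1: "mpow \<rho> 1 = \<rho>"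
  using p_pos by (simp only: mpow_rho) (simp add: rho less_imp_le)

lemma cadj_mpow: "cadj (mpow \<rho> t) = mpow \<rho> t"
  by (simp add: mpow_rho cadj_udiag)

lemma sinner_wt: "sinner \<rho> s A B = trace (cadj A ** wt B)"
  by (simp add: sinner_def wt_def matrix_mul_assoc)

lemma Re_sinner: "Re (sinner \<rho> s A B) = form A B"
  by (simp add: sinner_wt form_def inner_cmat)

lemma linear_wt: "linear wt"
  unfolding wt_def by (rule linear_matrix_sandwich)

lemma wt_one: "wt (mat 1) = \<rho>"
  by (simp add: wt_def mpow_add mpow_1)

lemma sinner_cnj: "sinner \<rho> s B A = cnj (sinner \<rho> s A B)"
proof -
  have "cnj (sinner \<rho> s A B) = trace (mpow \<rho> s ** (cadj B ** mpow \<rho> (1 - s) ** A))"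
    by (simp add: sinner_def cadj_mult cadj_mpow matrix_mul_assoc flip: trace_cadj)
  also have "\<dots> = sinner \<rho> s B A"
    by (subst trace_mul_sym) (simp add: sinner_def)
  finally show ?thesis by simp
qed

lemma form_sym: "form A B = form B A"
  using sinner_cnj[of A B] by (simp flip: Re_sinner)

lemma bilinear_form: "bilinear form"
  unfolding bilinear_def form_def
  using linear_wt by (auto intro!: linearI simp: linear_add linear_scale inner_add_left inner_add_right)

text \<open>Each power of \<rho> is split into two equal halves and one factor is moved cyclically
  through the trace. Positivity of the form is then evident, and definiteness follows because the
  halves are invertible.\<close>

lemma form_eq_norm: "form X X = (norm (mpow \<rho> ((1 - s) / 2) ** X ** mpow \<rho> (s / 2)))\<^sup>2"
proof -
  let ?R = "mpow \<rho> ((1 - s) / 2)" and ?S = "mpow \<rho> (s / 2)"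
  have "(norm (?R ** X ** ?S))\<^sup>2 = Re (trace (?S ** (cadj X ** (?R ** ?R) ** X ** ?S)))"
    by (simp add: power2_norm_eq_inner inner_cmat cadj_mult cadj_mpow matrix_mul_assoc)
  also have "\<dots> = Re (trace (cadj X ** (?R ** ?R) ** X ** (?S ** ?S)))"
    by (subst trace_mul_sym) (simp add: matrix_mul_assoc)
  also have "\<dots> = form X X"
    by (simp add: mpow_add sinner_def flip: Re_sinner)
  finally show ?thesis by simp
qed

lemma form_nonneg: "0 \<le> form X X"
  by (simp add: form_eq_norm)

lemma form_pos: "X \<noteq> 0 \<Longrightarrow> 0 < form X X"
proof (rule ccontr)
  let ?R = "\<lambda>t. mpow \<rho> t"
  assume "X \<noteq> 0" "\<not> 0 < form X X"
  then have "?R ((1 - s) / 2) ** X ** ?R (s / 2) = 0"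
    by (simp add: form_eq_norm)
  then have "?R (- ((1 - s) / 2)) ** (?R ((1 - s) / 2) ** X ** ?R (s / 2)) ** ?R (- (s / 2)) = 0"
    by simp
  moreover have "?R (- ((1 - s) / 2)) ** (?R ((1 - s) / 2) ** X ** ?R (s / 2)) ** ?R (- (s / 2))
      = (?R (- ((1 - s) / 2)) ** ?R ((1 - s) / 2)) ** X ** (?R (s / 2) ** ?R (- (s / 2)))"
    by (simp only: matrix_mul_assoc)
  ultimately show False using \<open>X \<noteq> 0\<close> by (simp only: mpow_add) (simp add: mpow_0)
qed

lemma form_Cauchy_Schwarz: "\<bar>form X Y\<bar> \<le> sqrt (form X X) * sqrt (form Y Y)"
  using psd_form_Cauchy_Schwarz[OF bilinear_form form_sym subspace_UNIV form_nonneg, of X Y]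
  by (simp add: real_le_rsqrt flip: real_sqrt_mult)

lemma surj_wt: "surj wt"
proof -
  have "inj wt"
    unfolding linear_injective_0[OF linear_wt]
  proof (intro allI impI)
    fix X assume "wt X = 0"
    then have "form X X = 0" by (simp add: form_def)
    then show "X = 0" using form_pos[of X] by auto
  qed
  then show ?thesis using linear_wt linear_injective_imp_surjective by blast
qed

text \<open>The trace is the pairing with the identity, so orthogonality to the identity means that
  the image under \<open>wt\<close> is traceless.\<close>

lemma trace_wt: "trace (wt X) = cnj (sinner \<rho> s X (mat 1))"
  by (simp add: sinner_wt[of "mat 1"] flip: sinner_cnj)

lemma trace_rho: "trace \<rho> = 1"
  by (simp only: rho trace_udiag[OF V] p_sum of_real_1)

lemma is_state_rho: "is_state \<rho>"
  unfolding is_state_def using trace_rho p_pos by (simp add: rho psd_udiag less_imp_le)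

text \<open>Equivalence of norms in finite dimension. The lower bound for \<open>wt\<close> comes
  from c |X|^2 <= <X, wt X> <= |X| |wt X|.\<close>

lemma form_norm_bounds:
  obtains c C where "c > 0" "C > 0" "\<And>X. c * norm X \<le> norm (wt X)" "\<And>X. norm (wt X) \<le> C * norm X"
    "\<And>X. c * (norm X)\<^sup>2 \<le> form X X"
proof -
  obtain c where c: "c > 0" "\<And>X. c * (norm X)\<^sup>2 \<le> form X X"
    using quadratic_form_ge_norm[OF bilinear_form form_pos] by blast
  obtain C where C: "C > 0" "\<And>X. norm (wt X) \<le> C * norm X"
    using linear_bounded_pos[OF linear_wt] by blast
  have "c * norm X \<le> norm (wt X)" for X
  proof (cases "X = 0")
    case False
    have "(c * norm X) * norm X \<le> norm X * norm (wt X)"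
      using c(2)[of X] norm_cauchy_schwarz[of X "wt X"] by (simp add: form_def power2_eq_square mult_ac)
    then show ?thesis using False by simp
  qed simp
  with c C that show ?thesis by blast
qed

section \<open>Detailed balance as self-adjointness; contraction and spectral gap\<close>

lemma detailed_balance_form:
  "detailed_balance \<rho> s T \<Longrightarrow> form A (hs_adj T B) = form (hs_adj T A) B"
  unfolding detailed_balance_def Re_sinner[symmetric] by simp

lemma detailed_balance_wt:
  assumes "detailed_balance \<rho> s (wkraus I c F)"
  shows "wt (hs_adj (wkraus I c F) X) = wkraus I c F (wt X)"
proof -
  have "inner A (wt (hs_adj (wkraus I c F) X)) = inner A (wkraus I c F (wt X))" for A
    using detailed_balance_form[OF assms, of A X] by (simp add: form_def inner_wkraus)
  then show ?thesis using vector_eq_ldot by blast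
qed

lemma linear_hs_adj_wkraus: "linear (hs_adj (wkraus I c F))"
  by (simp add: hs_adj_wkraus linear_wkraus)

text \<open>Through \<open>wt\<close> the iterates of the dual are orbits of the channel, hence
  bounded; a power-bounded self-adjoint map cannot expand any vector.\<close>

lemma detailed_balance_contraction:
  assumes db: "detailed_balance \<rho> s (wkraus I c F)" and T: "positive_tp (wkraus I c F)"
  shows "form (hs_adj (wkraus I c F) X) (hs_adj (wkraus I c F) X) \<le> form X X"
proof -
  let ?T = "wkraus I c F" and ?S = "hs_adj (wkraus I c F)"
  obtain b B where b: "b > 0" "\<And>X. b * norm X \<le> norm (wt X)"
    using form_norm_bounds by metis
  obtain C where C: "\<And>k. norm ((?T ^^ k) (wt X)) \<le> C"
    using positive_tp_orbit_bounded[OF T, of "wt X"] by blast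
  have "C \<ge> 0" using C[of 0] norm_ge_zero order_trans by blast
  have wt_pow: "wt ((?S ^^ k) X) = (?T ^^ k) (wt X)" for k
    by (induction k) (auto simp: detailed_balance_wt[OF db])
  have "form ((?S ^^ k) X) ((?S ^^ k) X) \<le> C / b * C" for k
  proof -
    have "norm ((?S ^^ k) X) \<le> C / b"
      using b(2)[of "(?S ^^ k) X"] C[of k] b(1) by (simp add: wt_pow field_simps)
    moreover have "norm (wt ((?S ^^ k) X)) \<le> C" using C wt_pow by simp
    ultimately have "norm ((?S ^^ k) X) * norm (wt ((?S ^^ k) X)) \<le> C / b * C"
      using \<open>C \<ge> 0\<close> b(1) by (intro mult_mono) auto
    then show ?thesis
      using norm_cauchy_schwarz[of "(?S ^^ k) X" "wt ((?S ^^ k) X)"] by (simp add: form_def)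
  qed
  then show ?thesis
    using power_bounded_selfadjoint_contraction[of form ?S X, OF bilinear_form form_sym form_nonneg
        detailed_balance_form[OF db]] by blast
qed

lemma psd_perturbation:
  assumes A: "hermitian A"
  obtains \<delta> where "\<delta> > 0" "psd (\<rho> + \<delta> *\<^sub>R A)"
proof -
  have cdot_rho: "cdot x (\<rho> *v x) = complex_of_real (\<Sum>i\<in>UNIV. p i * (cmod ((cadj V *v x) $ i))\<^sup>2)" for x
    by (simp only: rho cdot_udiag)
  have bil: "bilinear (\<lambda>x y. inner x (\<rho> *v y))"
    unfolding bilinear_def
    by (auto intro!: linearI simp: inner_add_left inner_add_right matrix_vector_right_distrib
        matrix_vector_scaleR_complex)
  have pos: "0 < inner x (\<rho> *v x)" if "x \<noteq> 0" for x
  proof -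
    have "V *v (cadj V *v x) = x"
      using V by (simp add: matrix_vector_mul_assoc unitary_def)
    then have "cadj V *v x \<noteq> 0" using that by auto
    then obtain i where "(cadj V *v x) $ i \<noteq> 0" by (auto simp: vec_eq_iff)
    then have "0 < (\<Sum>i\<in>UNIV. p i * (cmod ((cadj V *v x) $ i))\<^sup>2)"
      using p_pos by (intro sum_pos2[of _ i]) (auto simp: less_imp_le)
    then show ?thesis unfolding Re_cdot[symmetric] cdot_rho by simp
  qed
  obtain c where c: "c > 0" "\<And>x. c * (norm x)\<^sup>2 \<le> inner x (\<rho> *v x)"
    using quadratic_form_ge_norm[OF bil pos] by blast
  obtain B where B: "B > 0" "\<And>x. norm (A *v x) \<le> B * norm x"
    using linear_bounded_pos[OF matrix_vector_mul_linear[of A]] by blast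
  \<comment> \<open>\<open>c\<close> bounds the quadratic form of \<rho> from below and
    \<open>B\<close> bounds \<open>A\<close> as an operator, so this step is small enough not to
    leave the positive cone.\<close>
  define \<delta> where "\<delta> = c / B"
  have "psd (\<rho> + \<delta> *\<^sub>R A)"
    unfolding psd_altdef
  proof
    fix x
    have "Im (cdot x (A *v x)) = 0"
      using A cdot_cnj[of x "A *v x"] cdot_matrix_right[of x A x]
      by (simp add: hermitian_def complex_eq_iff)
    moreover have "0 \<le> inner x (\<rho> *v x) + \<delta> * inner x (A *v x)"
    proof -
      have "\<bar>inner x (A *v x)\<bar> \<le> norm x * (B * norm x)"
        using Cauchy_Schwarz_ineq2[of x "A *v x"] B(2)[of x]
        by (meson mult_left_mono norm_ge_zero order_trans)
      then have "\<delta> * \<bar>inner x (A *v x)\<bar> \<le> \<delta> * (norm x * (B * norm x))"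
        using c B by (intro mult_left_mono) (auto simp: \<delta>_def)
      also have "\<dots> = c * (norm x)\<^sup>2"
        using B by (simp add: \<delta>_def power2_eq_square)
      finally have "\<bar>\<delta> * inner x (A *v x)\<bar> \<le> c * (norm x)\<^sup>2"
        using c B by (simp add: \<delta>_def abs_mult)
      then show ?thesis using c(2)[of x] by linarith
    qed
    ultimately show "Im (cdot x ((\<rho> + \<delta> *\<^sub>R A) *v x)) = 0 \<and> 0 \<le> Re (cdot x ((\<rho> + \<delta> *\<^sub>R A) *v x))"
      by (simp add: matrix_vector_mult_add_rdistrib scaleR_matrix_vector_complex cdot_add_right
          cdot_scaleR_right cdot_rho) (simp add: Re_cdot[symmetric] cdot_rho)
  qed
  moreover have "\<delta> > 0" using c B by (simp add: \<delta>_def)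
  ultimately show ?thesis using that by blast
qed

text \<open>A traceless Hermitian fixed point could be added to \<rho> in a small multiple, giving a
  second fixed state. The general case follows because both Cartesian parts of a fixed matrix are
  fixed.\<close>

lemma unique_fixed_state_traceless:
  assumes T: "positive_tp T" and fix_rho: "T \<rho> = \<rho>"
    and uniq: "\<forall>\<sigma>. is_state \<sigma> \<and> T \<sigma> = \<sigma> \<longrightarrow> \<sigma> = \<rho>"
    and Z: "T Z = Z" "trace Z = 0"
  shows "Z = 0"
proof -
  have lin: "linear T" and T_cscale: "\<And>c X. T (cscale c X) = cscale c (T X)"
    and T_cadj: "\<And>X. T (cadj X) = cadj (T X)"
    using T by (auto simp: positive_tp_def)
  have herm0: "A = 0" if A: "hermitian A" "T A = A" "trace A = 0" for A
  proof -
    obtain \<delta> where \<delta>: "\<delta> > 0" "psd (\<rho> + \<delta> *\<^sub>R A)"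
      using psd_perturbation[OF A(1)] .
    have "is_state (\<rho> + \<delta> *\<^sub>R A)"
      using \<delta> A by (simp add: is_state_def trace_add trace_scaleR trace_rho)
    moreover have "T (\<rho> + \<delta> *\<^sub>R A) = \<rho> + \<delta> *\<^sub>R A"
      using fix_rho A by (simp add: linear_add[OF lin] linear_scale[OF lin])
    ultimately have "\<rho> + \<delta> *\<^sub>R A = \<rho>" using uniq by blast
    then show "A = 0" using \<delta> by simp
  qed
  obtain A B where AB: "hermitian A" "hermitian B" "Z = A + cscale \<i> B"
    "A = (1/2) *\<^sub>R (Z + cadj Z)" "B = cscale (- \<i> / 2) (Z - cadj Z)"
    using hermitian_cartesian_decomposition .
  have "A = 0"
    using Z by (intro herm0 AB(1))
      (simp_all add: AB(4) linear_add[OF lin] linear_scale[OF lin] T_cadj trace_scaleR trace_add trace_cadj)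
  moreover have "B = 0"
    using Z by (intro herm0 AB(2))
      (simp_all add: AB(5) linear_diff[OF lin] T_cscale T_cadj trace_cscale trace_sub trace_cadj)
  ultimately show ?thesis using AB(3) by (simp add: cscale_def vec_eq_iff)
qed

lemma subspace_orthogonal_one: "subspace {X. sinner \<rho> s X (mat 1) = 0}"
proof -
  have "{X. sinner \<rho> s X (mat 1) = 0} = {X. trace (wt X) = 0}"
    by (simp add: trace_wt)
  then show ?thesis
    by (simp add: subspace_def linear_add[OF linear_wt] linear_scale[OF linear_wt] linear_0[OF linear_wt]
        trace_add trace_scaleR trace_0[simplified])
qed

text \<open>\<open>l\<close> is the largest eigenvalue of the dual on the complement of the
  identity. The formula for the gap is conditional on a nonzero \<open>X\<close> there, since in
  dimension one the supremum ranges over the empty set.\<close>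

lemma detailed_balance_gap:
  assumes T: "T = wkraus I (\<lambda>_. 1) F" and unital: "(\<Sum>i\<in>I. cadj (F i) ** F i) = mat 1"
    and db: "detailed_balance \<rho> s T"
    and fix_rho: "T \<rho> = \<rho>"
    and uniq: "\<forall>\<sigma>. is_state \<sigma> \<and> T \<sigma> = \<sigma> \<longrightarrow> \<sigma> = \<rho>"
    and spec: "map_spectrum T \<subseteq> complex_of_real ` {0..1}"
  obtains l where "0 \<le> l" "l < 1"
    "\<And>X. sinner \<rho> s X (mat 1) = 0 \<Longrightarrow> form (hs_adj T X) (hs_adj T X) \<le> l\<^sup>2 * form X X"
    "\<And>X. X \<noteq> 0 \<Longrightarrow> sinner \<rho> s X (mat 1) = 0 \<Longrightarrow> gap \<rho> s T = 1 - l"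
proof -
  let ?S = "hs_adj T"
  define W where "W = {X. sinner \<rho> s X (mat 1) = 0}"
  have W: "subspace W" unfolding W_def by (rule subspace_orthogonal_one)
  have linS: "linear ?S" unfolding T by (rule linear_hs_adj_wkraus)
  have S1: "?S (mat 1) = mat 1" by (simp add: T hs_adj_wkraus) (simp add: wkraus_def unital)
  have SW: "?S X \<in> W" if "X \<in> W" for X
    using db that S1 unfolding detailed_balance_def W_def by (metis mem_Collect_eq)
  have sa: "form A (?S B) = form (?S A) B" for A B
    by (rule detailed_balance_form[OF db])
  have wtS: "wt (?S X) = T (wt X)" for X
    using detailed_balance_wt db unfolding T by blast
  have wt_nz: "wt X \<noteq> 0" if "X \<noteq> 0" for X
    using form_pos[OF that] by (auto simp: form_def)
  \<comment> \<open>\<open>wt\<close> turns an eigenvector of the dual into one of \<open>T\<close>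
    with the same eigenvalue, which transfers the assumption on the spectrum of
    \<open>T\<close>.\<close>
  have eig: "0 \<le> l" "l \<le> 1" if "X \<noteq> 0" "?S X = l *\<^sub>R X" for X l
  proof -
    have "T (wt X) = cscale (complex_of_real l) (wt X)"
      using that by (simp add: cscale_of_real linear_scale[OF linear_wt] flip: wtS)
    then have "complex_of_real l \<in> map_spectrum T"
      using wt_nz[OF that(1)] by (auto simp: map_spectrum_def)
    then show "0 \<le> l" "l \<le> 1" using spec by auto
  qed
  \<comment> \<open>A maximal eigenvector of the negated dual is a minimal one of the dual, so
    nonnegative eigenvalues give a nonnegative quadratic form.\<close>
  have psdS: "0 \<le> form X (?S X)" for X
  proof -
    have nz: "(UNIV :: 'd cmat set) \<noteq> {0}"
      using trace_rho by (metis UNIV_I singletonD trace_0 mat_0 zero_neq_one)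
    define R where "R X = - ?S X" for X
    have lin: "linear R" unfolding R_def using linS by (rule linear_compose_neg)
    have neg: "form A (- B) = - form A B" "form (- A) B = - form A B" for A B
      using bilinear_lneg[OF bilinear_form] bilinear_rneg[OF bilinear_form] by auto
    have saR: "form A (R B) = form (R A) B" for A B
      by (simp only: neg sa R_def)
    show ?thesis
    proof (rule selfadjoint_max_eigenvector[of form R UNIV, OF bilinear_form form_sym form_pos lin saR subspace_UNIV nz])
      fix Y m assume Y: "Y \<noteq> 0" "R Y = m *\<^sub>R Y"
        and le: "\<And>Z. Z \<in> UNIV \<Longrightarrow> form Z (R Z) \<le> m * form Z Z"
      have "?S Y = (- m) *\<^sub>R Y" using Y(2) unfolding R_def by (metis add.inverse_inverse scaleR_minus_left)
      from eig(1)[OF Y(1) this] have "m \<le> 0" by simp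
      then have "m * form X X \<le> 0" using form_nonneg by (rule mult_nonpos_nonneg)
      then show ?thesis using le[of X] by (simp add: neg R_def)
    qed auto
  qed
  show ?thesis
  proof (cases "W = {0}")
    \<comment> \<open>The complement is trivial, so 0 is an arbitrary admissible choice of
      \<open>l\<close>.\<close>
    case True
    then have "X = 0" if "sinner \<rho> s X (mat 1) = 0" for X
      using that by (auto simp: W_def)
    then show ?thesis
      using linear_0[OF linS] by (intro that[of 0]) (force simp: bilinear_lzero[OF bilinear_form])+
  next
    case False
    obtain X l where X: "X \<in> W" "X \<noteq> 0" "?S X = l *\<^sub>R X"
      and le: "\<And>Z. Z \<in> W \<Longrightarrow> form Z (?S Z) \<le> l * form Z Z"
      using selfadjoint_max_eigenvector[of form ?S W, OF bilinear_form form_sym form_pos linS sa W False SW]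
      by metis
    have "l \<noteq> 1"
    proof
      assume "l = 1"
      then have "T (wt X) = wt X" using X by (simp flip: wtS)
      moreover have "trace (wt X) = 0" using X by (simp add: trace_wt W_def)
      moreover have "positive_tp T" unfolding T by (rule positive_tp_wkraus[OF unital])
      ultimately have "wt X = 0" using unique_fixed_state_traceless fix_rho uniq by blast
      then show False using wt_nz X by blast
    qed
    then have l: "0 \<le> l" "l < 1" using eig[OF X(2,3)] by auto
    have norm_le: "form (?S Z) (?S Z) \<le> l\<^sup>2 * form Z Z" if "Z \<in> W" for Z
      using psd_selfadjoint_norm_le[where B = form and A = ?S and W = W and l = l,
          OF bilinear_form form_sym form_nonneg linS sa W SW psdS le that] .
    have "Sup {Re (sinner \<rho> s X (?S X)) / Re (sinner \<rho> s X X) | X. X \<noteq> 0 \<and> sinner \<rho> s X (mat 1) = 0} = l"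
    proof (rule cSup_eq_maximum)
      have "form X (?S X) / form X X = l"
        using X form_pos[OF X(2)] by (simp add: bilinear_rmul[OF bilinear_form])
      then show "l \<in> {Re (sinner \<rho> s X (?S X)) / Re (sinner \<rho> s X X) | X. X \<noteq> 0 \<and> sinner \<rho> s X (mat 1) = 0}"
        using X by (auto simp: Re_sinner W_def intro!: exI[of _ X])
    next
      fix x assume "x \<in> {Re (sinner \<rho> s X (?S X)) / Re (sinner \<rho> s X X) | X. X \<noteq> 0 \<and> sinner \<rho> s X (mat 1) = 0}"
      then obtain Z where "Z \<in> W" "Z \<noteq> 0" "x = form Z (?S Z) / form Z Z"
        by (auto simp: Re_sinner W_def)
      then show "x \<le> l" using le[of Z] form_pos[of Z] by (simp add: pos_divide_le_eq)
    qed
    then have "gap \<rho> s T = 1 - l" by (simp add: gap_def)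
    then show ?thesis using that[OF l norm_le] by (simp add: W_def)
  qed
qed

text \<open>A \<open>LEAST\<close> satisfies its defining property only once some witness is known;
  here it is a time, uniform in the initial state, given by geometric convergence.\<close>

lemma t_mix_trace_norm:
  assumes T: "positive_tp T" and fix_rho: "T \<rho> = \<rho>"
    and wtS: "\<And>X. wt (S X) = T (wt X)"
    and SW: "\<And>X. sinner \<rho> s X (mat 1) = 0 \<Longrightarrow> sinner \<rho> s (S X) (mat 1) = 0"
    and l: "0 \<le> l" "l < 1"
    and contr: "\<And>X. sinner \<rho> s X (mat 1) = 0 \<Longrightarrow> form (S X) (S X) \<le> l\<^sup>2 * form X X"
    and eta: "\<eta> > 0" and state: "is_state \<sigma>"
  shows "trace_norm ((T ^^ t_mix T \<rho> \<eta>) \<sigma> - \<rho>) \<le> \<eta>"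
proof -
  obtain c C where c: "c > 0" "C > 0" "\<And>X. c * norm X \<le> norm (wt X)" "\<And>X. norm (wt X) \<le> C * norm X"
    "\<And>X. c * (norm X)\<^sup>2 \<le> form X X"
    using form_norm_bounds by blast
  have rho_pow: "(T ^^ t) \<rho> = \<rho>" for t
    by (induction t) (auto simp: fix_rho)
  have bound: "norm ((T ^^ t) \<sigma> - \<rho>) \<le> C * (l ^ t * (2 / c))" if "is_state \<sigma>" for \<sigma> t
  proof -
    have Tt: "positive_tp (T ^^ t)" by (rule positive_tp_funpow[OF T])
    have tr: "trace (\<sigma> - \<rho>) = 0" using that by (simp add: is_state_def trace_sub trace_rho)
    \<comment> \<open>The deviation from equilibrium is traceless, so it is the image of an
      observable orthogonal to the identity, where the contraction acts.\<close>
    obtain X where X: "wt X = \<sigma> - \<rho>" using surj_wt by (metis surjD)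
    have X0: "sinner \<rho> s X (mat 1) = 0" using tr X trace_wt[of X] by simp
    have iter: "sinner \<rho> s ((S ^^ t) X) (mat 1) = 0 \<and> form ((S ^^ t) X) ((S ^^ t) X) \<le> (l ^ t)\<^sup>2 * form X X \<and>
        wt ((S ^^ t) X) = (T ^^ t) (wt X)" for t
    proof (induction t)
      case (Suc t)
      have "form (S ((S ^^ t) X)) (S ((S ^^ t) X)) \<le> l\<^sup>2 * form ((S ^^ t) X) ((S ^^ t) X)"
        using Suc contr by blast
      also have "\<dots> \<le> l\<^sup>2 * ((l ^ t)\<^sup>2 * form X X)"
        using Suc by (intro mult_left_mono) auto
      finally show ?case using Suc SW wtS by (simp add: power_mult_distrib)
    qed (simp add: X0)
    have "norm \<sigma> \<le> 1" "norm \<rho> \<le> 1"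
      using psd_trace(3)[of \<sigma>] psd_trace(3)[of \<rho>] that is_state_rho by (auto simp: is_state_def)
    then have nX: "norm (wt X) \<le> 2"
      unfolding X using norm_triangle_ineq4[of \<sigma> \<rho>] by linarith
    \<comment> \<open>Both c |X| and |wt X| are at most 2, since states have Frobenius norm at most
      1; this is the origin of 4/c.\<close>
    have "c * form X X \<le> (c * norm X) * norm (wt X)"
      using norm_cauchy_schwarz[of X "wt X"] c(1) by (simp add: form_def)
    also have "\<dots> \<le> 2 * 2"
      using nX c(1) c(3)[of X] by (intro mult_mono) auto
    finally have fX: "form X X \<le> 4 / c" using c(1) by (simp add: field_simps)
    have "c * (norm ((S ^^ t) X))\<^sup>2 \<le> (l ^ t)\<^sup>2 * (4 / c)"
      using c(5)[of "(S ^^ t) X"] iter[of t] mult_left_mono[OF fX, of "(l ^ t)\<^sup>2"] by simp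
    then have "(norm ((S ^^ t) X))\<^sup>2 \<le> (l ^ t)\<^sup>2 * (4 / c) / c"
      using c(1) by (simp add: pos_le_divide_eq mult.commute)
    also have "\<dots> = (l ^ t * (2 / c))\<^sup>2"
      unfolding power_mult_distrib power_divide by (simp add: power2_eq_square)
    finally have "(norm ((S ^^ t) X))\<^sup>2 \<le> (l ^ t * (2 / c))\<^sup>2" .
    then have "norm ((S ^^ t) X) \<le> l ^ t * (2 / c)"
      by (rule power2_le_imp_le) (use l c(1) in simp)
    then have "norm (wt ((S ^^ t) X)) \<le> C * (l ^ t * (2 / c))"
      using c(4)[of "(S ^^ t) X"] c(2) by (meson mult_left_mono order_trans less_imp_le)
    moreover have "wt ((S ^^ t) X) = (T ^^ t) \<sigma> - \<rho>"
      using iter[of t] Tt by (simp add: X positive_tp_def linear_diff rho_pow)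
    ultimately show ?thesis by simp
  qed
  have "\<exists>t. \<forall>\<sigma>. is_state \<sigma> \<longrightarrow> trace_norm ((T ^^ t) \<sigma> - \<rho>) \<le> \<eta>"
  proof -
    \<comment> \<open>The dimension comes from comparing the trace norm with the Frobenius norm, the
      other factors from \<open>bound\<close>.\<close>
    define K where "K = real CARD('d) * C * (2 / c)"
    have K: "K > 0" using c by (simp add: K_def)
    then obtain t where t: "l ^ t < \<eta> / K"
      using real_arch_pow_inv[of "\<eta> / K" l] l eta by auto
    have "trace_norm ((T ^^ t) \<sigma> - \<rho>) \<le> \<eta>" if "is_state \<sigma>" for \<sigma>
    proof -
      have "is_state ((T ^^ t) \<sigma>)"
        using positive_tp_is_state[OF positive_tp_funpow[OF T] that] .
      then have "hermitian ((T ^^ t) \<sigma>)" "hermitian \<rho>"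
        using psd_hermitian is_state_rho by (auto simp: is_state_def)
      then have "hermitian ((T ^^ t) \<sigma> - \<rho>)"
        by (simp add: hermitian_def cadj_diff)
      then have "trace_norm ((T ^^ t) \<sigma> - \<rho>) \<le> CARD('d) * norm ((T ^^ t) \<sigma> - \<rho>)"
        by (rule trace_norm_hermitian_le)
      also have "\<dots> \<le> CARD('d) * (C * (l ^ t * (2 / c)))"
        using bound[OF that, of t] by (intro mult_left_mono) auto
      also have "\<dots> = K * l ^ t" by (simp add: K_def)
      also have "\<dots> \<le> \<eta>" using t K by (simp add: field_simps)
      finally show ?thesis .
    qed
    then show ?thesis by blast
  qed
  then have "\<forall>\<sigma>. is_state \<sigma> \<longrightarrow> trace_norm ((T ^^ t_mix T \<rho> \<eta>) \<sigma> - \<rho>) \<le> \<eta>"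
    unfolding t_mix_def by (rule LeastI_ex)
  then show ?thesis using state by blast
qed

end

subsection \<open>Moments of the recorded outcomes\<close>

lemma linear_rounds:
  assumes "linear T"
  shows "linear (rounds T U Ob es)"
proof (induction es)
  case Nil
  show ?case by (simp add: linear_id[unfolded id_def])
next
  case (Cons e es)
  have "linear (rounds T U Ob es \<circ> (meas_channel U Ob \<circ> (T \<circ> (\<lambda>X. Ob e ** X ** cadj (Ob e)))))"
    by (intro linear_compose Cons assms linear_matrix_sandwich)
       (simp add: meas_channel_wkraus linear_wkraus)
  then show ?case by (simp add: o_def)
qed

lemma psd_rounds:
  assumes "\<And>X. psd X \<Longrightarrow> psd (T X)" "psd X"
  shows "psd (rounds T U Ob es X)"
  using assms(2)
proof (induction es arbitrary: X)
  case (Cons e es)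
  have "psd (meas_channel U Ob (T (Ob e ** X ** cadj (Ob e))))"
    unfolding meas_channel_wkraus by (intro psd_wkraus assms(1) psd_sandwich Cons.prems) simp
  then show ?case by (simp add: Cons.IH)
qed simp

text \<open>For a state \<open>X\<close> this is the expectation of \<open>g\<close> over the
  recorded outcomes. It is taken for arbitrary \<open>X\<close> because differences of states and
  inputs reweighted by an outcome also occur.\<close>

definition weighted_rounds :: "('d::finite cmat \<Rightarrow> 'd cmat) \<Rightarrow> real set \<Rightarrow> (real \<Rightarrow> 'd cmat) \<Rightarrow> nat
    \<Rightarrow> (real list \<Rightarrow> real) \<Rightarrow> 'd cmat \<Rightarrow> real" where
  "weighted_rounds T U Ob k g X =
     (\<Sum>es\<in>{es. set es \<subseteq> U \<and> length es = k}. g es * Re (trace (rounds T U Ob es X)))"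

lemma traj_prob_weighted_rounds:
  "traj_prob T U Ob \<sigma> t k P = weighted_rounds T U Ob k (\<lambda>es. of_bool (P es)) ((T ^^ t) \<sigma>)"
  unfolding traj_prob_def weighted_rounds_def by (intro sum.cong) auto

lemma linear_weighted_rounds:
  assumes "linear T"
  shows "linear (weighted_rounds T U Ob k g)"
proof -
  have "linear (\<lambda>X. Re (trace (rounds T U Ob es X)))" for es
    using linear_rounds[OF assms, of U Ob es]
    by (intro linearI) (simp_all add: linear_add linear_scale trace_add trace_scaleR)
  then show ?thesis
    unfolding weighted_rounds_def real_scaleR_def[symmetric]
    by (intro linear_compose_sum ballI linear_compose_scale_right)
qed

lemma weighted_rounds_0: "weighted_rounds T U Ob 0 g X = g [] * Re (trace X)"
proof -
  have "{es. set es \<subseteq> U \<and> length es = 0} = {[]}" by auto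
  then show ?thesis by (simp add: weighted_rounds_def)
qed

lemma weighted_rounds_Suc:
  "weighted_rounds T U Ob (Suc k) g X =
     (\<Sum>e\<in>U. weighted_rounds T U Ob k (\<lambda>es. g (e # es)) (meas_channel U Ob (T (Ob e ** X ** cadj (Ob e)))))"
proof -
  let ?L = "\<lambda>k. {es. set es \<subseteq> U \<and> length es = k}"
  have L: "?L (Suc k) = (\<lambda>(e, es). e # es) ` (U \<times> ?L k)"
    by (auto simp: lists_length_Suc_eq image_iff length_Suc_conv)
  have inj: "inj_on (\<lambda>(e, es). e # es) (U \<times> ?L k)"
    by (auto simp: inj_on_def)
  show ?thesis
    unfolding weighted_rounds_def L sum.reindex[OF inj]
    by (simp add: sum.cartesian_product case_prod_unfold)
qed

lemma weighted_rounds_combine: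
  "weighted_rounds T U Ob k (\<lambda>es. a * g es + h es) X =
     a * weighted_rounds T U Ob k g X + weighted_rounds T U Ob k h X"
  by (simp add: weighted_rounds_def distrib_right sum.distrib sum_distrib_left mult_ac)

lemma weighted_rounds_mono:
  assumes "\<And>X. psd X \<Longrightarrow> psd (T X)" "psd X" "\<And>es. length es = k \<Longrightarrow> g es \<le> h es"
  shows "weighted_rounds T U Ob k g X \<le> weighted_rounds T U Ob k h X"
  unfolding weighted_rounds_def
  using psd_trace(2)[OF psd_rounds[OF assms(1,2)]]
  by (intro sum_mono mult_right_mono) (auto intro: assms(3))

lemma weighted_rounds_const:
  assumes T: "positive_tp T" and meas: "is_measurement U Ob"
  shows "weighted_rounds T U Ob k (\<lambda>es. 1) X = Re (trace X)"
proof (induction k arbitrary: X)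
  case 0
  then show ?case by (simp add: weighted_rounds_0)
next
  case (Suc k)
  have "weighted_rounds T U Ob (Suc k) (\<lambda>es. 1) X = (\<Sum>e\<in>U. Re (trace (Ob e ** X ** cadj (Ob e))))"
    using T by (simp add: weighted_rounds_Suc Suc trace_meas_channel[OF meas] positive_tp_def)
  also have "\<dots> = Re (trace (meas_channel U Ob X))"
    by (simp add: meas_channel_def trace_sum)
  finally show ?case by (simp add: trace_meas_channel[OF meas])
qed

text \<open>With P the absolute value of \<open>A\<close>, replacing \<open>A\<close> by P and then
  \<open>g\<close> by 1 only increases the value, and the total weight of P is the trace
  norm.\<close>

lemma weighted_rounds_le_trace_norm:
  assumes T: "positive_tp T" and meas: "is_measurement U Ob"
    and g: "\<And>es. 0 \<le> g es" "\<And>es. g es \<le> 1" and A: "hermitian A"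
  shows "weighted_rounds T U Ob k g A \<le> trace_norm A"
proof -
  obtain P where P: "psd P" "psd (P - A)" "Re (trace P) = trace_norm A"
    using hermitian_abs_decomposition[OF A] by blast
  have psdT: "psd (T X)" if "psd X" for X using T that by (simp add: positive_tp_def)
  have lin: "linear (weighted_rounds T U Ob k g)"
    using T by (intro linear_weighted_rounds) (simp add: positive_tp_def)
  have "weighted_rounds T U Ob k (\<lambda>_. 0) (P - A) \<le> weighted_rounds T U Ob k g (P - A)"
    using g by (intro weighted_rounds_mono psdT P)
  then have "weighted_rounds T U Ob k g A \<le> weighted_rounds T U Ob k g P"
    by (simp add: linear_diff[OF lin] weighted_rounds_def[of T U Ob k "\<lambda>_. 0"])
  also have "\<dots> \<le> weighted_rounds T U Ob k (\<lambda>_. 1) P"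
    using g by (intro weighted_rounds_mono psdT P)
  also have "\<dots> = trace_norm A" by (simp add: weighted_rounds_const[OF T meas] P)
  finally show ?thesis .
qed

section \<open>Recursions for the first and second moments\<close>

definition centred_sum :: "real \<Rightarrow> real list \<Rightarrow> real" where
  "centred_sum \<mu> es = (\<Sum>e\<leftarrow>es. e - \<mu>)"

lemma centred_sum_Cons: "centred_sum \<mu> (e # es) = (e - \<mu>) + centred_sum \<mu> es"
  by (simp add: centred_sum_def)

lemma centred_sum_eq: "centred_sum \<mu> es = sum_list es - real (length es) * \<mu>"
  by (induction es) (auto simp: centred_sum_def algebra_simps)

lemma sum_linear_wkraus:
  fixes L :: "'d::finite cmat \<Rightarrow> real"
  assumes "linear L"
  shows "(\<Sum>e\<in>U. c e * L (Ob e ** X ** cadj (Ob e))) = L (wkraus U c Ob X)"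
  using assms by (simp add: wkraus_def linear_sum linear_scale)

lemma Re_trace_wkraus: "Re (trace (wkraus I c F X)) = (\<Sum>i\<in>I. c i * Re (trace (F i ** X ** cadj (F i))))"
  by (simp add: wkraus_def trace_sum trace_scaleR)

text \<open>Each round starts by weighting with the outcome of the first measurement, so splitting off
  the first outcome expresses a moment of the remaining rounds at a reweighted input.\<close>
lemma weighted_rounds_first_moment_Suc:
  assumes T: "positive_tp T" and meas: "is_measurement U Ob"
  defines "M \<equiv> meas_channel U Ob"
  shows "weighted_rounds T U Ob (Suc k) (centred_sum \<mu>) X =
    Re (trace (wkraus U (\<lambda>e. e - \<mu>) Ob X)) + weighted_rounds T U Ob k (centred_sum \<mu>) (M (T (M X)))"
proof -
  have linT: "linear T" using T by (simp add: positive_tp_def)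
  have linM: "linear M" by (simp add: M_def meas_channel_wkraus linear_wkraus)
  have lin: "linear (\<lambda>X. weighted_rounds T U Ob k g (M (T X)))" for g
    using linear_compose[OF linear_compose[OF linT linM] linear_weighted_rounds[OF linT, of U Ob k g]]
    by (simp add: o_def)
  have split: "(\<lambda>es. centred_sum \<mu> (e # es)) = (\<lambda>es. (e - \<mu>) * 1 + centred_sum \<mu> es)" for e
    by (simp add: centred_sum_Cons)
  have trMT: "trace (M (T Y)) = trace Y" for Y
    using T by (simp add: M_def trace_meas_channel[OF meas] positive_tp_def)
  have "weighted_rounds T U Ob (Suc k) (centred_sum \<mu>) X =
      (\<Sum>e\<in>U. (e - \<mu>) * weighted_rounds T U Ob k (\<lambda>_. 1) (M (T (Ob e ** X ** cadj (Ob e))))) +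
      (\<Sum>e\<in>U. 1 * weighted_rounds T U Ob k (centred_sum \<mu>) (M (T (Ob e ** X ** cadj (Ob e)))))"
    unfolding weighted_rounds_Suc split weighted_rounds_combine by (simp add: sum.distrib M_def)
  then show ?thesis
    unfolding sum_linear_wkraus[OF lin] weighted_rounds_const[OF T meas] trMT
    by (simp add: M_def meas_channel_wkraus Re_trace_wkraus)
qed

text \<open>Expanding the square splits off the first outcome. The cross term is a first moment of
  the remaining rounds, started from the signed matrix obtained by weighting the input with that
  outcome.\<close>

lemma weighted_rounds_second_moment_Suc:
  assumes T: "positive_tp T" and meas: "is_measurement U Ob"
  defines "M \<equiv> meas_channel U Ob"
  shows "weighted_rounds T U Ob (Suc k) (\<lambda>es. (centred_sum \<mu> es)\<^sup>2) X =
    Re (trace (wkraus U (\<lambda>e. (e - \<mu>)\<^sup>2) Ob X)) +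
    2 * weighted_rounds T U Ob k (centred_sum \<mu>) (M (T (wkraus U (\<lambda>e. e - \<mu>) Ob X))) +
    weighted_rounds T U Ob k (\<lambda>es. (centred_sum \<mu> es)\<^sup>2) (M (T (M X)))"
proof -
  have linT: "linear T" using T by (simp add: positive_tp_def)
  have linM: "linear M" by (simp add: M_def meas_channel_wkraus linear_wkraus)
  have lin: "linear (\<lambda>X. weighted_rounds T U Ob k g (M (T X)))" for g
    using linear_compose[OF linear_compose[OF linT linM] linear_weighted_rounds[OF linT, of U Ob k g]]
    by (simp add: o_def)
  have split: "(\<lambda>es. (centred_sum \<mu> (e # es))\<^sup>2) =
      (\<lambda>es. (e - \<mu>)\<^sup>2 * 1 + (2 * (e - \<mu>) * centred_sum \<mu> es + (centred_sum \<mu> es)\<^sup>2))" for e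
    by (intro ext) (simp add: centred_sum_Cons power2_eq_square algebra_simps)
  have trMT: "trace (M (T Y)) = trace Y" for Y
    using T by (simp add: M_def trace_meas_channel[OF meas] positive_tp_def)
  have "weighted_rounds T U Ob (Suc k) (\<lambda>es. (centred_sum \<mu> es)\<^sup>2) X =
      (\<Sum>e\<in>U. (e - \<mu>)\<^sup>2 * weighted_rounds T U Ob k (\<lambda>_. 1) (M (T (Ob e ** X ** cadj (Ob e))))) +
      2 * (\<Sum>e\<in>U. (e - \<mu>) * weighted_rounds T U Ob k (centred_sum \<mu>) (M (T (Ob e ** X ** cadj (Ob e))))) +
      (\<Sum>e\<in>U. 1 * weighted_rounds T U Ob k (\<lambda>es. (centred_sum \<mu> es)\<^sup>2) (M (T (Ob e ** X ** cadj (Ob e)))))"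
    unfolding weighted_rounds_Suc split weighted_rounds_combine
    by (simp only: sum.distrib M_def sum_distrib_left mult.assoc mult_1_left add.assoc)
  then show ?thesis
    unfolding sum_linear_wkraus[OF lin] weighted_rounds_const[OF T meas] trMT
    by (simp add: M_def meas_channel_wkraus Re_trace_wkraus)
qed

subsection \<open>Concentration of the empirical mean\<close>

context faithful_state
begin

text \<open>Here \<open>a\<close> and \<open>m\<close> play the duals of \<open>T\<close> and of the
  measurement channel. One round contributes \<open>form Y X\<close> and replaces \<open>X\<close>
  by a vector at most \<open>l\<close> times as long, still orthogonal to the identity; 1/(1-l)
  solves b = 1 + l b, so the bound reproduces itself.\<close>

lemma first_moment_bound:
  fixes Ob :: "real \<Rightarrow> 'd cmat" and \<mu> :: real
  assumes T: "positive_tp T" and meas: "is_measurement U Ob"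
    and wta: "\<And>X. wt (a X) = T (wt X)" and wtm: "\<And>X. wt (m X) = meas_channel U Ob (wt X)"
    and aW: "\<And>X. sinner \<rho> s X (mat 1) = 0 \<Longrightarrow> sinner \<rho> s (a X) (mat 1) = 0"
    and mW: "\<And>X. sinner \<rho> s X (mat 1) = 0 \<Longrightarrow> sinner \<rho> s (m X) (mat 1) = 0"
    and a_le: "\<And>X. sinner \<rho> s X (mat 1) = 0 \<Longrightarrow> form (a X) (a X) \<le> l\<^sup>2 * form X X"
    and m_le: "\<And>X. form (m X) (m X) \<le> form X X"
    and l: "0 \<le> l" "l < 1" and X: "sinner \<rho> s X (mat 1) = 0"
  defines "Y \<equiv> hs_adj (wkraus U (\<lambda>e. e - \<mu>) Ob) (mat 1)"
  shows "\<bar>weighted_rounds T U Ob k (centred_sum \<mu>) (wt X)\<bar> \<le> sqrt (form Y Y) * sqrt (form X X) / (1 - l)"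
  using X
proof (induction k arbitrary: X)
  case 0
  then show ?case using l form_nonneg by (simp add: weighted_rounds_0 centred_sum_def)
next
  case (Suc k)
  let ?Z = "m (a (m X))" and ?n = "\<lambda>X. sqrt (form X X)"
  have "Re (trace (wkraus U (\<lambda>e. e - \<mu>) Ob (wt X))) = inner (mat 1) (wkraus U (\<lambda>e. e - \<mu>) Ob (wt X))"
    by (simp add: inner_cmat)
  also have "\<dots> = form Y X" by (simp add: inner_wkraus form_def Y_def)
  finally have "weighted_rounds T U Ob (Suc k) (centred_sum \<mu>) (wt X) =
      form Y X + weighted_rounds T U Ob k (centred_sum \<mu>) (wt ?Z)"
    unfolding weighted_rounds_first_moment_Suc[OF T meas] wtm wta by simp
  moreover have "\<bar>form Y X\<bar> \<le> ?n Y * ?n X" by (rule form_Cauchy_Schwarz)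
  moreover have "\<bar>weighted_rounds T U Ob k (centred_sum \<mu>) (wt ?Z)\<bar> \<le> ?n Y * (l * ?n X) / (1 - l)"
  proof -
    have "form ?Z ?Z \<le> l\<^sup>2 * form (m X) (m X)"
      using m_le a_le mW Suc.prems by (meson order_trans)
    also have "\<dots> \<le> l\<^sup>2 * form X X" by (intro mult_left_mono m_le) simp
    finally have "?n ?Z \<le> l * ?n X"
      using l by (metis real_sqrt_le_iff real_sqrt_mult real_sqrt_unique)
    then have "?n Y * ?n ?Z / (1 - l) \<le> ?n Y * (l * ?n X) / (1 - l)"
      using l form_nonneg by (intro divide_right_mono mult_left_mono) auto
    moreover have "sinner \<rho> s ?Z (mat 1) = 0" using aW mW Suc.prems by blast
    ultimately show ?thesis using Suc.IH by (meson order_trans)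
  qed
  moreover have "?n Y * ?n X + ?n Y * (l * ?n X) / (1 - l) = ?n Y * ?n X / (1 - l)"
    using l by (simp add: field_simps)
  ultimately show ?case by linarith
qed

text \<open>By stationarity every round starts again from \<rho>, so each contributes one variance
  term and twice the correlation of its outcome with all later ones.\<close>

lemma second_moment_bound:
  fixes Ob :: "real \<Rightarrow> 'd cmat" and \<mu> :: real
  assumes T: "positive_tp T" and meas: "is_measurement U Ob"
    and wta: "\<And>X. wt (a X) = T (wt X)" and wtm: "\<And>X. wt (m X) = meas_channel U Ob (wt X)"
    and aW: "\<And>X. sinner \<rho> s X (mat 1) = 0 \<Longrightarrow> sinner \<rho> s (a X) (mat 1) = 0"
    and mW: "\<And>X. sinner \<rho> s X (mat 1) = 0 \<Longrightarrow> sinner \<rho> s (m X) (mat 1) = 0"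
    and a_le: "\<And>X. sinner \<rho> s X (mat 1) = 0 \<Longrightarrow> form (a X) (a X) \<le> l\<^sup>2 * form X X"
    and m_le: "\<And>X. form (m X) (m X) \<le> form X X"
    and l: "0 \<le> l" "l < 1"
  defines "Y \<equiv> hs_adj (wkraus U (\<lambda>e. e - \<mu>) Ob) (mat 1)"
  assumes Y: "sinner \<rho> s Y (mat 1) = 0" and wtY: "wt Y = wkraus U (\<lambda>e. e - \<mu>) Ob \<rho>"
    and T_rho: "T \<rho> = \<rho>" and M_rho: "meas_channel U Ob \<rho> = \<rho>"
  shows "weighted_rounds T U Ob k (\<lambda>es. (centred_sum \<mu> es)\<^sup>2) \<rho> \<le>
    real k * (Re (trace (wkraus U (\<lambda>e. (e - \<mu>)\<^sup>2) Ob \<rho>)) + 2 * (form Y Y / (1 - l)))"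
proof (induction k)
  case 0
  then show ?case by (simp add: weighted_rounds_0 centred_sum_def)
next
  case (Suc k)
  let ?Z = "m (a Y)"
  have "form ?Z ?Z \<le> l\<^sup>2 * form Y Y"
    using m_le a_le Y by (meson order_trans)
  \<comment> \<open>The factor \<open>l\<close> gained before the next recorded outcome is given
    away: the geometric series starts at 1, which gives the term Cov / gap in the bound on
    K.\<close>
  also have "\<dots> \<le> 1 * form Y Y"
    using l form_nonneg by (intro mult_right_mono) (auto simp: power_le_one)
  finally have "sqrt (form Y Y) * sqrt (form ?Z ?Z) / (1 - l) \<le> sqrt (form Y Y) * sqrt (form Y Y) / (1 - l)"
    using l form_nonneg by (intro divide_right_mono mult_left_mono) auto
  moreover have "sinner \<rho> s ?Z (mat 1) = 0" using aW mW Y by blast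
  then have "\<bar>weighted_rounds T U Ob k (centred_sum \<mu>) (wt ?Z)\<bar> \<le> sqrt (form Y Y) * sqrt (form ?Z ?Z) / (1 - l)"
    using first_moment_bound[OF T meas wta wtm aW mW a_le m_le l, of "m (a Y)" k \<mu>] by (simp only: Y_def)
  ultimately have "weighted_rounds T U Ob k (centred_sum \<mu>) (wt ?Z) \<le> form Y Y / (1 - l)"
    using form_nonneg[of Y] by simp
  moreover have "weighted_rounds T U Ob (Suc k) (\<lambda>es. (centred_sum \<mu> es)\<^sup>2) \<rho> =
      Re (trace (wkraus U (\<lambda>e. (e - \<mu>)\<^sup>2) Ob \<rho>)) + 2 * weighted_rounds T U Ob k (centred_sum \<mu>) (wt ?Z) +
      weighted_rounds T U Ob k (\<lambda>es. (centred_sum \<mu> es)\<^sup>2) \<rho>"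
    unfolding weighted_rounds_second_moment_Suc[OF T meas] by (simp add: M_rho T_rho wtY wta wtm)
  ultimately show ?case
    using Suc.IH by (simp only: of_nat_Suc distrib_right mult_1_left)
qed

end

section \<open>Moments of the measurement and the concentration bound\<close>

lemma meas_V_eq: "meas_V U Ob \<rho> = Re (trace (wkraus U (\<lambda>e. (e - meas_E U Ob \<rho>)\<^sup>2) Ob \<rho>))"
  by (simp add: meas_V_def wkraus_def trace_sum trace_scaleR outcome_prob_def)

lemma meas_Cov_eq: "meas_Cov U Ob \<rho> = Re (trace (meas_hat U Ob \<rho> (meas_hat U Ob \<rho> \<rho>)))"
proof -
  let ?\<mu> = "meas_E U Ob \<rho>"
  have "Re (trace (meas_hat U Ob \<rho> (meas_hat U Ob \<rho> \<rho>))) = (\<Sum>y\<in>U. \<Sum>x\<in>U. (x - ?\<mu>) * (y - ?\<mu>) *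
      Re (trace (Ob y ** Ob x ** \<rho> ** cadj (Ob x) ** cadj (Ob y))))"
    by (simp add: meas_hat_def matrix_sum_ldistrib matrix_sum_rdistrib matrix_scaleR_left matrix_scaleR_right
        trace_sum trace_scaleR sum_distrib_left matrix_mul_assoc mult_ac)
  then show ?thesis unfolding meas_Cov_def by (subst (asm) sum.swap) simp
qed

lemma trace_meas_hat:
  assumes "is_measurement U Ob" "is_state \<rho>"
  shows "trace (meas_hat U Ob \<rho> \<rho>) = 0"
proof -
  let ?\<mu> = "meas_E U Ob \<rho>"
  have tr: "trace (Ob u ** \<rho> ** cadj (Ob u)) = complex_of_real (outcome_prob Ob \<rho> u)" for u
    unfolding outcome_prob_def using assms(2) psd_sandwich psd_trace(1) is_state_def by metis
  have "trace (meas_channel U Ob \<rho>) = 1"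
    using assms by (simp add: trace_meas_channel is_state_def)
  then have one: "(\<Sum>u\<in>U. outcome_prob Ob \<rho> u) = 1"
    by (simp add: meas_channel_def trace_sum tr flip: of_real_sum)
  have "trace (meas_hat U Ob \<rho> \<rho>) = complex_of_real (\<Sum>u\<in>U. (u - ?\<mu>) * outcome_prob Ob \<rho> u)"
    by (simp add: meas_hat_def trace_sum trace_scaleR tr scaleR_conv_of_real[where 'a=complex])
  also have "(\<Sum>u\<in>U. (u - ?\<mu>) * outcome_prob Ob \<rho> u) = ?\<mu> - ?\<mu> * (\<Sum>u\<in>U. outcome_prob Ob \<rho> u)"
    by (simp add: left_diff_distrib sum_subtractf sum_distrib_left meas_E_def)
  finally show ?thesis by (simp add: one)
qed

theorem theorem5p7:
  fixes n :: nat and H :: "'d::finite cmat" and \<beta> s \<epsilon> \<eta> :: real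
    and N :: "'d cmat \<Rightarrow> 'd cmat" and U :: "real set" and Ob :: "real \<Rightarrow> 'd cmat"
    and \<rho> :: "'d cmat" and K :: nat
  assumes qubits: "CARD('d) = 2 ^ n"
    and herm: "hermitian H" and beta: "\<beta> > 0"
    and s: "0 \<le> s" "s \<le> 1"
    and N_ch: "is_channel N"
    and M_meas: "is_measurement U Ob"
    and N_db: "detailed_balance (gibbs \<beta> H) s N"
    and M_db: "detailed_balance (gibbs \<beta> H) s (meas_channel U Ob)"
    and N_fix: "N (gibbs \<beta> H) = gibbs \<beta> H"
    and N_unique: "\<forall>\<sigma>. is_state \<sigma> \<and> N \<sigma> = \<sigma> \<longrightarrow> \<sigma> = gibbs \<beta> H"
    and N_spec: "map_spectrum N \<subseteq> complex_of_real ` {0..1}"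
    and Mhat_db: "detailed_balance (gibbs \<beta> H) s (meas_hat U Ob (gibbs \<beta> H))"
    and V_pos: "meas_V U Ob (gibbs \<beta> H) > 0"
    and init: "is_state \<rho>"
    and eps: "\<epsilon> > 0" and eta: "\<eta> > 0"
    and K_bound: "real K \<ge> 2 * meas_V U Ob (gibbs \<beta> H) / (\<epsilon>^2 * \<eta>) *
        ((meas_Cov U Ob (gibbs \<beta> H) / meas_V U Ob (gibbs \<beta> H)) / gap (gibbs \<beta> H) s N + 1/2)"
  shows "traj_prob N U Ob \<rho> (t_mix N (gibbs \<beta> H) \<eta>) K
           (\<lambda>es. \<bar>sum_list es / real K - meas_E U Ob (gibbs \<beta> H)\<bar> \<ge> \<epsilon>) \<le> 2 * \<eta>"
proof -
  define \<gamma> where "\<gamma> = gibbs \<beta> H"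
  note gibbs_fold = \<gamma>_def[symmetric]
  obtain W p where "unitary W" "\<gamma> = udiag W p" "\<And>i. 0 < p i" "(\<Sum>i\<in>UNIV. p i) = 1"
    using gibbs_udiag[OF herm, of \<beta>] unfolding gibbs_fold by blast
  then interpret faithful_state W p \<gamma> s by unfold_locales
  obtain m F where N: "N = wkraus {..<m::nat} (\<lambda>_. 1) F" "(\<Sum>i<m. cadj (F i) ** F i) = mat 1"
    using channel_wkraus[OF N_ch] by blast
  have N_tp: "positive_tp N" unfolding N(1) by (rule positive_tp_wkraus[OF N(2)])
  let ?M = "meas_channel U Ob" and ?Mh = "meas_hat U Ob \<gamma>"
  define \<mu> where "\<mu> = meas_E U Ob \<gamma>"
  define V where "V = meas_V U Ob \<gamma>"
  define Y where "Y = hs_adj ?Mh (mat 1)"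
  have Mh: "?Mh = wkraus U (\<lambda>e. e - \<mu>) Ob" unfolding \<mu>_def by (rule meas_hat_wkraus)
  have unital: "(\<Sum>u\<in>U. cadj (Ob u) ** Ob u) = mat 1" using M_meas by (simp add: is_measurement_def)
  have M_tp: "positive_tp ?M" unfolding meas_channel_wkraus by (rule positive_tp_wkraus[OF unital])
  have N_one: "hs_adj N (mat 1) = mat 1"
    using N(2) by (simp add: N(1) hs_adj_wkraus) (simp add: wkraus_def)
  have M_one: "hs_adj ?M (mat 1) = mat 1"
    using unital by (simp add: meas_channel_wkraus hs_adj_wkraus) (simp add: wkraus_def)
  have wtN: "wt (hs_adj N X) = N (wt X)" for X
    using detailed_balance_wt N_db unfolding N(1) gibbs_fold by blast
  have wtM: "wt (hs_adj ?M X) = ?M (wt X)" for X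
    using detailed_balance_wt M_db unfolding meas_channel_wkraus gibbs_fold by blast
  have wtMh: "wt (hs_adj ?Mh X) = ?Mh (wt X)" for X
    using detailed_balance_wt Mhat_db unfolding Mh gibbs_fold by blast
  have NW: "sinner \<gamma> s (hs_adj N X) (mat 1) = 0" if "sinner \<gamma> s X (mat 1) = 0" for X
    using N_db that N_one unfolding detailed_balance_def gibbs_fold by metis
  have MW: "sinner \<gamma> s (hs_adj ?M X) (mat 1) = 0" if "sinner \<gamma> s X (mat 1) = 0" for X
    using M_db that M_one unfolding detailed_balance_def gibbs_fold by metis
  have M_le: "form (hs_adj ?M X) (hs_adj ?M X) \<le> form X X" for X
    using detailed_balance_contraction M_db M_tp unfolding meas_channel_wkraus gibbs_fold by blast
  \<comment> \<open>Invariance of the Gibbs state under the measurement is derived: the dual fixes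
    the identity, and \<open>wt\<close> carries the identity to \<gamma>.\<close>
  have M_fix: "?M \<gamma> = \<gamma>" using wtM[of "mat 1"] by (simp add: M_one wt_one)
  have wtY: "wt Y = ?Mh \<gamma>" using wtMh[of "mat 1"] by (simp add: Y_def wt_one)
  have Y_orth: "sinner \<gamma> s Y (mat 1) = 0"
    using trace_wt[of Y] trace_meas_hat[OF M_meas is_state_rho] by (simp add: wtY)
  \<comment> \<open>Detailed balance rewrites the inner application of Mhat as \<open>wt Y\<close>;
    the outer one moves to the other side of the trace, where it acts on the identity and gives a
    second \<open>Y\<close>.\<close>
  have Cov: "meas_Cov U Ob \<gamma> = form Y Y"
  proof -
    have "meas_Cov U Ob \<gamma> = inner (mat 1) (?Mh (wt Y))"
      by (simp add: meas_Cov_eq wtY inner_cmat)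
    also have "\<dots> = inner Y (wt Y)"
      unfolding Y_def Mh by (rule inner_wkraus)
    finally show ?thesis by (simp add: form_def)
  qed
  obtain l where l: "0 \<le> l" "l < 1"
    and N_le: "\<And>X. sinner \<gamma> s X (mat 1) = 0 \<Longrightarrow> form (hs_adj N X) (hs_adj N X) \<le> l\<^sup>2 * form X X"
    and gap: "\<And>X. X \<noteq> 0 \<Longrightarrow> sinner \<gamma> s X (mat 1) = 0 \<Longrightarrow> gap \<gamma> s N = 1 - l"
    using detailed_balance_gap[OF N N_db[folded \<gamma>_def] N_fix[folded \<gamma>_def] N_unique[folded \<gamma>_def] N_spec]
    by blast
  \<comment> \<open>In dimension one the gap is an unspecified supremum over the empty set, but then \<open>Y = 0\<close>.\<close>
  have Cov_gap: "form Y Y / gap \<gamma> s N = form Y Y / (1 - l)"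
    using gap[OF _ Y_orth] by (cases "Y = 0") (simp_all add: bilinear_lzero[OF bilinear_form])
  define B where "B = V + 2 * (form Y Y / (1 - l))"
  have V: "V > 0" using V_pos by (simp add: V_def \<gamma>_def)
  have B: "B > 0" using V l form_nonneg[of Y] by (simp add: B_def add_pos_nonneg)
  have "2 * V / (\<epsilon>\<^sup>2 * \<eta>) * (form Y Y / V / gap \<gamma> s N + 1 / 2) = B / (\<epsilon>\<^sup>2 * \<eta>)"
  proof -
    have *: "form Y Y / V / gap \<gamma> s N = form Y Y / (1 - l) / V"
      by (simp add: divide_divide_eq_left mult.commute flip: Cov_gap)
    show ?thesis unfolding * B_def using V eps eta l by (simp add: field_simps)
  qed
  with K_bound have "B / (\<epsilon>\<^sup>2 * \<eta>) \<le> real K"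
    unfolding gibbs_fold Cov V_def[symmetric] by metis
  then have K: "B \<le> real K * (\<epsilon>\<^sup>2 * \<eta>)" using eps eta by (simp add: field_simps)
  \<comment> \<open>The empirical mean divides by \<open>K\<close>. Positivity is forced by the
    bound on \<open>K\<close>, because \<open>B\<close> is at least the positive variance.\<close>
  have K_pos: "real K > 0"
  proof (rule ccontr)
    assume "\<not> real K > 0"
    then show False using K B by simp
  qed
  let ?g = "\<lambda>es. of_bool (\<epsilon> \<le> \<bar>sum_list es / real K - \<mu>\<bar>) :: real"
  let ?t = "t_mix N \<gamma> \<eta>"
  have "weighted_rounds N U Ob K (\<lambda>es. (centred_sum \<mu> es)\<^sup>2) \<gamma> \<le> real K * B"
    using second_moment_bound[OF N_tp M_meas wtN wtM NW MW N_le M_le l, of \<mu> K] Y_orth wtY N_fix M_fix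
    unfolding Y_def Mh B_def V_def meas_V_eq gibbs_fold \<mu>_def by blast
  moreover have "weighted_rounds N U Ob K ?g \<gamma> \<le>
      weighted_rounds N U Ob K (\<lambda>es. 1 / (real K * \<epsilon>)\<^sup>2 * (centred_sum \<mu> es)\<^sup>2 + 0) \<gamma>"
  proof (rule weighted_rounds_mono)
    show "psd (N X)" if "psd X" for X using N_tp that by (simp add: positive_tp_def)
    show "psd \<gamma>" using is_state_rho by (simp add: is_state_def)
    fix es :: "real list" assume len: "length es = K"
    show "?g es \<le> 1 / (real K * \<epsilon>)\<^sup>2 * (centred_sum \<mu> es)\<^sup>2 + 0"
    proof (cases "\<epsilon> \<le> \<bar>sum_list es / real K - \<mu>\<bar>")
      case True
      have "centred_sum \<mu> es = real K * (sum_list es / real K - \<mu>)"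
        using K_pos by (simp add: centred_sum_eq len field_simps)
      then have "real K * \<epsilon> \<le> \<bar>centred_sum \<mu> es\<bar>"
        using True K_pos by (simp add: abs_mult)
      then have "(real K * \<epsilon>)\<^sup>2 \<le> (centred_sum \<mu> es)\<^sup>2"
        using K_pos eps abs_le_square_iff[of "real K * \<epsilon>" "centred_sum \<mu> es"] by simp
      then show ?thesis using True K_pos eps by (simp add: field_simps)
    qed simp
  qed
  moreover have "weighted_rounds N U Ob K (\<lambda>es. 1 / (real K * \<epsilon>)\<^sup>2 * (centred_sum \<mu> es)\<^sup>2 + 0) \<gamma> =
      1 / (real K * \<epsilon>)\<^sup>2 * weighted_rounds N U Ob K (\<lambda>es. (centred_sum \<mu> es)\<^sup>2) \<gamma>"
    unfolding weighted_rounds_combine by (simp add: weighted_rounds_def)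
  moreover have "1 / (real K * \<epsilon>)\<^sup>2 * (real K * B) \<le> \<eta>"
  proof -
    have "real K * B \<le> real K * (real K * (\<epsilon>\<^sup>2 * \<eta>))" using K K_pos by (intro mult_left_mono) auto
    also have "\<dots> = (real K * \<epsilon>)\<^sup>2 * \<eta>" by (simp add: power2_eq_square)
    finally show ?thesis using K_pos eps by (simp add: field_simps)
  qed
  ultimately have stationary: "weighted_rounds N U Ob K ?g \<gamma> \<le> \<eta>"
    using mult_left_mono[of "weighted_rounds N U Ob K (\<lambda>es. (centred_sum \<mu> es)\<^sup>2) \<gamma>" "real K * B" "1 / (real K * \<epsilon>)\<^sup>2"]
    by simp
  \<comment> \<open>Linearity in the input splits the event probability into the stationary one and
    the contribution of this deviation, each at most \<eta>.\<close>
  let ?D = "(N ^^ ?t) \<rho> - \<gamma>"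
  have "is_state ((N ^^ ?t) \<rho>)"
    using positive_tp_is_state[OF positive_tp_funpow[OF N_tp] init] .
  then have "hermitian ((N ^^ ?t) \<rho>)" "hermitian \<gamma>"
    using psd_hermitian is_state_rho by (auto simp: is_state_def)
  then have "hermitian ?D" by (simp add: hermitian_def cadj_diff)
  then have "weighted_rounds N U Ob K ?g ?D \<le> trace_norm ?D"
    by (intro weighted_rounds_le_trace_norm N_tp M_meas) auto
  also have "\<dots> \<le> \<eta>"
    using t_mix_trace_norm[OF N_tp N_fix[folded \<gamma>_def] wtN NW l N_le eta init] .
  finally have "weighted_rounds N U Ob K ?g ((N ^^ ?t) \<rho>) \<le> \<eta> + weighted_rounds N U Ob K ?g \<gamma>"
    using N_tp by (simp add: linear_diff[OF linear_weighted_rounds] positive_tp_def)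
  then show ?thesis
    using stationary unfolding traj_prob_weighted_rounds gibbs_fold \<mu>_def by linarith
qed

end
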